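(* Let $1\to (A,\mathbf{1})\xrightarrow{\iota} (B,\mu)\xrightarrow{\pi} (C,\lambda)\to 1$ be a proper extension of partially crossed topological $G$-$R$-bimodules with continuous sections. Then the following sequence (of pointed sets) is exact: $$0\to H^{0}(G,A)\xrightarrow{\iota^{0}} H^{0}(G,B)\xrightarrow{\pi^{0}} H^{0}(G,C)\xrightarrow{\delta^{0}} H^{1}(G,A)\xrightarrow{\iota^{1}} H^{1}(G,(B,\mu))\xrightarrow{\pi^{1}} H^{1}(G,(C,\lambda))\xrightarrow{\delta^{1}} H^{2}(G,A).$$
   Context: Topological groups are not assumed abelian. A topological $G$-module is a topological group $A$ with a continuous left action of the topological group $G$ on $A$ by group automorphisms, written ${}^{g}a$. Every group acts on itself by conjugation. A precrossed topological $R$-module $(A,\mu)$ is a topological $R$-module $A$ with a continuous homomorphism $\mu:A\to R$ such that $\mu({}^{r}a)=r\mu(a)r^{-1}$. It is partially crossed if ${}^{\mu(a)}b=aba^{-1}$ for all $b\in A$ and all $a\in A$ with $\mu(a)\in[R,R]$. A partially crossed topological $G$-$R$-bimodule is a partially crossed topological $R$-module $(A,\mu)$ such that the topological group $G$ acts continuously on $R$ and $A$ (by automorphisms), $\mu({}^{g}a)={}^{g}\mu(a)$, and ${}^{({}^{g}r)}a={}^{g}({}^{r}({}^{g^{-1}}a))$ for all $g\in G,r\in R,a\in A$. A morphism $f:(A,\mu)\to(B,\nu)$ of such bimodules is a continuous homomorphism $f:A\to B$ commuting with the actions of $R$ and of $G$ and such that $\mu=\nu\circ f$. $\mathbf 1$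 denotes the trivial homomorphism. A proper extension with continuous sections is a sequence of morphisms of partially crossed topological $G$-$R$-bimodules $1\to (A,\mathbf{1})\xrightarrow{\iota} (B,\mu)\xrightarrow{\pi} (C,\lambda)\to 1$ (so $\mu\circ\iota=\mathbf 1$, $\lambda\circ\pi=\mu$) such that $1\to A\to B\to C\to 1$ is an exact sequence of groups, $\iota$ is a homeomorphic embedding, $\pi$ is open, and $\pi$ has a continuous section $s:C\to B$ (a continuous map with $\pi s=\mathrm{Id}_C$). (Since $(A,\mathbf 1)$ is partially crossed, $A$ is abelian, and $\iota(A)\subset \ker\mu$ is central in $B$.) Identify $A$ with $\iota(A)$. For a topological $G$-module $M$: $H^0(G,M)=\{m: {}^{g}m=m\ \forall g\in G\}$; $H^1(G,M)$ is the set of continuous crossed homomorphisms $\alpha:G\to M$ ($\alpha(gh)=\alpha(g)\,{}^{g}\alpha(h)$) modulo $\alpha\sim\beta$ iff there is $m\in M$ with $\beta(g)=m^{-1}\alpha(g)\,{}^{g}m$ for all $g$. For abelian $M$, $H^2(G,M)$ is the group of continuous 2-cocycles $f:G\times G\to M$ (i.e. ${}^{g}f(h,k)f(g,hk)=f(gh,k)f(g,h)$) modulo the coboundaries $(g,h)\mapsto {}^{g}\kappa(h)\kappa(gh)^{-1}\kappa(g)$ with $\kappa:G\to M$ continuous. $Der_{c}(G,(B,\mu))$ is the set of pairs $(\alpha,r)$ with $\alpha:G\to B$ a continuous crossed homomorphism and $r\in R$ such that $\mu(\alpha(g))=r\,{}^{g}r^{-1}$ for all $g\in G$. Put $(\alpha,r)\sim'(\beta,t)$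 if there is $b\in B$ with $\beta(g)=b^{-1}\alpha(g)\,{}^{g}b$ for all $g\in G$ and $t\in\mu(b)^{-1}rH^{0}(G,R)$. $H^{1}(G,(B,\mu))=Der_{c}(G,(B,\mu))/\!\sim'$, with base point the class of $(\mathbf 1,1)$; similarly for $(C,\lambda)$. Maps: $\iota^0,\pi^0$ are the restrictions of $\iota,\pi$; $\delta^0(c)$ is the class of $g\mapsto b^{-1}\,{}^{g}b$ for any $b\in B$ with $\pi(b)=c$; $\iota^1([\alpha])=[(\iota\circ\alpha,1)]$; $\pi^1([(\beta,r)])=[(\pi\circ\beta,r)]$; $\delta^1([(\alpha,r)])=[\tilde\alpha]$ with $\tilde\alpha(g,h)=s\alpha(g)\,{}^{g}(s\alpha(h))\,(s\alpha(gh))^{-1}$ for a continuous section $s$ of $\pi$ (the class does not depend on $s$). Exactness is exactness of pointed sets (kernel = preimage of the base point). *)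

theory Defs
  imports "HOL-Analysis.Product_Topology" "HOL-Algebra.Generated_Groups"
begin

section \<open>Topological groups and topological modules\<close>

record 'a topgroup = "'a monoid" +
  topo :: "'a topology"

text \<open>No separation axiom is imposed, and the group need not be abelian.\<close>

locale topological_group = group G for G :: "('a, 'm) topgroup_scheme" (structure) +
  assumes topspace_topo: "topspace (topo G) = carrier G"
    and continuous_mult:
      "continuous_map (prod_topology (topo G) (topo G)) (topo G) (\<lambda>(x, y). x \<otimes> y)"
    and continuous_inv: "continuous_map (topo G) (topo G) (\<lambda>x. inv x)"

locale topological_module =
  G: topological_group G + A: topological_group A
  for G :: "('g, 'm) topgroup_scheme" and A :: "('a, 'n) topgroup_scheme"
    and act :: "'g \<Rightarrow> 'a \<Rightarrow> 'a" +
  assumes act_auto: "g \<in> carrier G \<Longrightarrow> act g \<in> iso A A"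
    and act_one: "a \<in> carrier A \<Longrightarrow> act \<one>\<^bsub>G\<^esub> a = a"
    and act_mult: "\<lbrakk>g \<in> carrier G; h \<in> carrier G; a \<in> carrier A\<rbrakk>
      \<Longrightarrow> act (g \<otimes>\<^bsub>G\<^esub> h) a = act g (act h a)"
    and continuous_act:
      "continuous_map (prod_topology (topo G) (topo A)) (topo A) (\<lambda>(g, a). act g a)"

section \<open>Partially crossed topological bimodules\<close>

locale precrossed_module = topological_module R A act
  for R :: "('r, 'm) topgroup_scheme" and A :: "('a, 'n) topgroup_scheme"
    and act :: "'r \<Rightarrow> 'a \<Rightarrow> 'a" and \<mu> :: "'a \<Rightarrow> 'r" +
  assumes mu_hom: "\<mu> \<in> hom A R"
    and continuous_mu: "continuous_map (topo A) (topo R) \<mu>"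
    and mu_act: "\<lbrakk>r \<in> carrier R; a \<in> carrier A\<rbrakk>
      \<Longrightarrow> \<mu> (act r a) = r \<otimes>\<^bsub>R\<^esub> \<mu> a \<otimes>\<^bsub>R\<^esub> inv\<^bsub>R\<^esub> r"

text \<open>The commutator subgroup \<open>[R, R]\<close> is the abstract one; no closure is taken.\<close>

locale partially_crossed_module = precrossed_module R A act \<mu>
  for R :: "('r, 'm) topgroup_scheme" and A :: "('a, 'n) topgroup_scheme"
    and act :: "'r \<Rightarrow> 'a \<Rightarrow> 'a" and \<mu> :: "'a \<Rightarrow> 'r" +
  assumes peiffer: "\<lbrakk>a \<in> carrier A; b \<in> carrier A; \<mu> a \<in> derived R (carrier R)\<rbrakk>
      \<Longrightarrow> act (\<mu> a) b = a \<otimes>\<^bsub>A\<^esub> b \<otimes>\<^bsub>A\<^esub> inv\<^bsub>A\<^esub> a"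

text \<open>
  A \<open>gmodule\<close> carries a \<open>G\<close>-action; a \<open>bimodule\<close> carries in addition an \<open>R\<close>-action and the
  structure map to \<open>R\<close>. The group \<open>R\<close>, on which \<open>G\<close> acts, is itself a \<open>gmodule\<close>.
\<close>

record ('a, 'g) gmodule = "'a topgroup" +
  gact :: "'g \<Rightarrow> 'a \<Rightarrow> 'a"

record ('a, 'g, 'r) bimodule = "('a, 'g) gmodule" +
  ract :: "'r \<Rightarrow> 'a \<Rightarrow> 'a"
  smap :: "'a \<Rightarrow> 'r"

locale partially_crossed_bimodule =
  GR: topological_module G R "gact R" +
  GA: topological_module G A "gact A" +
  RA: partially_crossed_module R A "ract A" "smap A"
  for G :: "('g, 'm) topgroup_scheme" and R :: "('r, 'g, 'n) gmodule_scheme"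
    and A :: "('a, 'g, 'r) bimodule" +
  assumes smap_gact: "\<lbrakk>g \<in> carrier G; a \<in> carrier A\<rbrakk>
      \<Longrightarrow> smap A (gact A g a) = gact R g (smap A a)"
    and act_compat: "\<lbrakk>g \<in> carrier G; r \<in> carrier R; a \<in> carrier A\<rbrakk>
      \<Longrightarrow> ract A (gact R g r) a = gact A g (ract A r (gact A (inv\<^bsub>G\<^esub> g) a))"

locale bimodule_morphism =
  A: partially_crossed_bimodule G R A + B: partially_crossed_bimodule G R B
  for G :: "('g, 'm) topgroup_scheme" and R :: "('r, 'g, 'n) gmodule_scheme"
    and A :: "('a, 'g, 'r) bimodule" and B :: "('b, 'g, 'r) bimodule" and f :: "'a \<Rightarrow> 'b" +
  assumes f_hom: "f \<in> hom A B"
    and continuous_f: "continuous_map (topo A) (topo B) f"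
    and f_ract: "\<lbrakk>r \<in> carrier R; a \<in> carrier A\<rbrakk> \<Longrightarrow> f (ract A r a) = ract B r (f a)"
    and f_gact: "\<lbrakk>g \<in> carrier G; a \<in> carrier A\<rbrakk> \<Longrightarrow> f (gact A g a) = gact B g (f a)"
    and smap_f: "a \<in> carrier A \<Longrightarrow> smap B (f a) = smap A a"

section \<open>Proper extensions with continuous sections\<close>

definition continuous_section ::
  "('b, 'm) topgroup_scheme \<Rightarrow> ('c, 'n) topgroup_scheme \<Rightarrow> ('b \<Rightarrow> 'c) \<Rightarrow> ('c \<Rightarrow> 'b) \<Rightarrow> bool" where
  "continuous_section B C \<pi> s \<longleftrightarrow>
     continuous_map (topo C) (topo B) s \<and> (\<forall>c \<in> carrier C. \<pi> (s c) = c)"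

locale proper_extension =
  iota: bimodule_morphism G R A B \<iota> + pi: bimodule_morphism G R B C \<pi>
  for G :: "('g, 'm) topgroup_scheme" and R :: "('r, 'g, 'n) gmodule_scheme"
    and A :: "('a, 'g, 'r) bimodule" and B :: "('b, 'g, 'r) bimodule"
    and C :: "('c, 'g, 'r) bimodule" and \<iota> :: "'a \<Rightarrow> 'b" and \<pi> :: "'b \<Rightarrow> 'c" +
  assumes smap_A: "a \<in> carrier A \<Longrightarrow> smap A a = \<one>\<^bsub>R\<^esub>"
    and iota_inj: "inj_on \<iota> (carrier A)"
    and exact_middle: "\<iota> ` carrier A = kernel B C \<pi>"
    and pi_surj: "\<pi> ` carrier B = carrier C"
    and iota_embedding: "embedding_map (topo A) (topo B) \<iota>"
    and pi_open: "open_map (topo B) (topo C) \<pi>"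
    and has_section: "\<exists>s. continuous_section B C \<pi> s"

section \<open>Cohomology\<close>

text \<open>
  Cochains are HOL functions whose values outside the carrier of \<open>G\<close> are irrelevant: the
  cocycle conditions and the relations only look at the carrier, so that two
  cochains agreeing there lie in the same class.
\<close>

definition H0 :: "('g, 'm) topgroup_scheme \<Rightarrow> ('a, 'g, 'n) gmodule_scheme \<Rightarrow> 'a set" where
  "H0 G M = {m \<in> carrier M. \<forall>g \<in> carrier G. gact M g m = m}"

definition crossed_homs ::
  "('g, 'm) topgroup_scheme \<Rightarrow> ('a, 'g, 'n) gmodule_scheme \<Rightarrow> ('g \<Rightarrow> 'a) set" where
  "crossed_homs G M = {\<alpha>. continuous_map (topo G) (topo M) \<alpha> \<and>
     (\<forall>g \<in> carrier G. \<forall>h \<in> carrier G. \<alpha> (g \<otimes>\<^bsub>G\<^esub> h) = \<alpha> g \<otimes>\<^bsub>M\<^esub> gact M g (\<alpha> h))}"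

definition H1_rel ::
  "('g, 'm) topgroup_scheme \<Rightarrow> ('a, 'g, 'n) gmodule_scheme \<Rightarrow> (('g \<Rightarrow> 'a) \<times> ('g \<Rightarrow> 'a)) set" where
  "H1_rel G M = {(\<alpha>, \<beta>). \<alpha> \<in> crossed_homs G M \<and> \<beta> \<in> crossed_homs G M \<and>
     (\<exists>m \<in> carrier M. \<forall>g \<in> carrier G. \<beta> g = inv\<^bsub>M\<^esub> m \<otimes>\<^bsub>M\<^esub> \<alpha> g \<otimes>\<^bsub>M\<^esub> gact M g m)}"

definition H1 ::
  "('g, 'm) topgroup_scheme \<Rightarrow> ('a, 'g, 'n) gmodule_scheme \<Rightarrow> ('g \<Rightarrow> 'a) set set" where
  "H1 G M = crossed_homs G M // H1_rel G M"

definition cocycles2 ::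
  "('g, 'm) topgroup_scheme \<Rightarrow> ('a, 'g, 'n) gmodule_scheme \<Rightarrow> ('g \<times> 'g \<Rightarrow> 'a) set" where
  "cocycles2 G M = {f. continuous_map (prod_topology (topo G) (topo G)) (topo M) f \<and>
     (\<forall>g \<in> carrier G. \<forall>h \<in> carrier G. \<forall>k \<in> carrier G.
        gact M g (f (h, k)) \<otimes>\<^bsub>M\<^esub> f (g, h \<otimes>\<^bsub>G\<^esub> k) = f (g \<otimes>\<^bsub>G\<^esub> h, k) \<otimes>\<^bsub>M\<^esub> f (g, h))}"

definition coboundary2 ::
  "('g, 'm) topgroup_scheme \<Rightarrow> ('a, 'g, 'n) gmodule_scheme \<Rightarrow> ('g \<Rightarrow> 'a) \<Rightarrow> 'g \<times> 'g \<Rightarrow> 'a" where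
  "coboundary2 G M \<kappa> = (\<lambda>(g, h). gact M g (\<kappa> h) \<otimes>\<^bsub>M\<^esub> inv\<^bsub>M\<^esub> (\<kappa> (g \<otimes>\<^bsub>G\<^esub> h)) \<otimes>\<^bsub>M\<^esub> \<kappa> g)"

text \<open>
  For abelian \<open>M\<close>, the classes of \<open>H2_rel\<close> are the cosets of the subgroup of coboundaries in the
  group of cocycles. Only the pointed set underlying that quotient group is recorded.
\<close>

definition H2_rel ::
  "('g, 'm) topgroup_scheme \<Rightarrow> ('a, 'g, 'n) gmodule_scheme
    \<Rightarrow> (('g \<times> 'g \<Rightarrow> 'a) \<times> ('g \<times> 'g \<Rightarrow> 'a)) set" where
  "H2_rel G M = {(f, f'). f \<in> cocycles2 G M \<and> f' \<in> cocycles2 G M \<and>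
     (\<exists>\<kappa>. continuous_map (topo G) (topo M) \<kappa> \<and>
        (\<forall>x \<in> carrier G \<times> carrier G. f' x = f x \<otimes>\<^bsub>M\<^esub> coboundary2 G M \<kappa> x))}"

definition H2 ::
  "('g, 'm) topgroup_scheme \<Rightarrow> ('a, 'g, 'n) gmodule_scheme \<Rightarrow> ('g \<times> 'g \<Rightarrow> 'a) set set" where
  "H2 G M = cocycles2 G M // H2_rel G M"

definition Der_c ::
  "('g, 'm) topgroup_scheme \<Rightarrow> ('r, 'g, 'n) gmodule_scheme \<Rightarrow> ('b, 'g, 'r) bimodule
    \<Rightarrow> (('g \<Rightarrow> 'b) \<times> 'r) set" where
  "Der_c G R B = {(\<alpha>, r). \<alpha> \<in> crossed_homs G B \<and> r \<in> carrier R \<and>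
     (\<forall>g \<in> carrier G. smap B (\<alpha> g) = r \<otimes>\<^bsub>R\<^esub> gact R g (inv\<^bsub>R\<^esub> r))}"

definition Der_rel ::
  "('g, 'm) topgroup_scheme \<Rightarrow> ('r, 'g, 'n) gmodule_scheme \<Rightarrow> ('b, 'g, 'r) bimodule
    \<Rightarrow> ((('g \<Rightarrow> 'b) \<times> 'r) \<times> (('g \<Rightarrow> 'b) \<times> 'r)) set" where
  "Der_rel G R B = {((\<alpha>, r), (\<beta>, t)). (\<alpha>, r) \<in> Der_c G R B \<and> (\<beta>, t) \<in> Der_c G R B \<and>
     (\<exists>b \<in> carrier B.
        (\<forall>g \<in> carrier G. \<beta> g = inv\<^bsub>B\<^esub> b \<otimes>\<^bsub>B\<^esub> \<alpha> g \<otimes>\<^bsub>B\<^esub> gact B g b) \<and>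
        t \<in> (inv\<^bsub>R\<^esub> (smap B b) \<otimes>\<^bsub>R\<^esub> r) <#\<^bsub>R\<^esub> H0 G R)}"

definition H1_pair ::
  "('g, 'm) topgroup_scheme \<Rightarrow> ('r, 'g, 'n) gmodule_scheme \<Rightarrow> ('b, 'g, 'r) bimodule
    \<Rightarrow> (('g \<Rightarrow> 'b) \<times> 'r) set set" where
  "H1_pair G R B = Der_c G R B // Der_rel G R B"

section \<open>The maps of the sequence\<close>

text \<open>
  Each map below is the union of the classes obtained from all admissible choices (representatives,
  preimages, sections); once the class is independent of the choices, the union is that class,
  whereas a union of distinct classes is not an element of the target quotient.
  The inverse of \<open>\<iota>\<close> implements the identification
  of \<open>A\<close> with its image in \<open>B\<close>.
\<close>

definition delta0 ::
  "('g, 'm) topgroup_scheme \<Rightarrow> ('a, 'g, 'r) bimodule \<Rightarrow> ('b, 'g, 'r) bimodule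
    \<Rightarrow> ('a \<Rightarrow> 'b) \<Rightarrow> ('b \<Rightarrow> 'c) \<Rightarrow> 'c \<Rightarrow> ('g \<Rightarrow> 'a) set" where
  "delta0 G A B \<iota> \<pi> c = (\<Union>b \<in> {b \<in> carrier B. \<pi> b = c}.
     H1_rel G A `` {\<lambda>g. inv_into (carrier A) \<iota> (inv\<^bsub>B\<^esub> b \<otimes>\<^bsub>B\<^esub> gact B g b)})"

definition iota1 ::
  "('g, 'm) topgroup_scheme \<Rightarrow> ('r, 'g, 'n) gmodule_scheme \<Rightarrow> ('b, 'g, 'r) bimodule
    \<Rightarrow> ('a \<Rightarrow> 'b) \<Rightarrow> ('g \<Rightarrow> 'a) set \<Rightarrow> (('g \<Rightarrow> 'b) \<times> 'r) set" where
  "iota1 G R B \<iota> X = (\<Union>\<alpha> \<in> X. Der_rel G R B `` {(\<iota> \<circ> \<alpha>, \<one>\<^bsub>R\<^esub>)})"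

definition pi1 ::
  "('g, 'm) topgroup_scheme \<Rightarrow> ('r, 'g, 'n) gmodule_scheme \<Rightarrow> ('c, 'g, 'r) bimodule
    \<Rightarrow> ('b \<Rightarrow> 'c) \<Rightarrow> (('g \<Rightarrow> 'b) \<times> 'r) set \<Rightarrow> (('g \<Rightarrow> 'c) \<times> 'r) set" where
  "pi1 G R C \<pi> X = (\<Union>(\<beta>, r) \<in> X. Der_rel G R C `` {(\<pi> \<circ> \<beta>, r)})"

definition delta1_cochain ::
  "('g, 'm) topgroup_scheme \<Rightarrow> ('a, 'g, 'r) bimodule \<Rightarrow> ('b, 'g, 'r) bimodule
    \<Rightarrow> ('a \<Rightarrow> 'b) \<Rightarrow> ('c \<Rightarrow> 'b) \<Rightarrow> ('g \<Rightarrow> 'c) \<Rightarrow> 'g \<times> 'g \<Rightarrow> 'a" where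
  "delta1_cochain G A B \<iota> s \<alpha> = (\<lambda>(g, h). inv_into (carrier A) \<iota>
     (s (\<alpha> g) \<otimes>\<^bsub>B\<^esub> gact B g (s (\<alpha> h)) \<otimes>\<^bsub>B\<^esub> inv\<^bsub>B\<^esub> (s (\<alpha> (g \<otimes>\<^bsub>G\<^esub> h)))))"

definition delta1 ::
  "('g, 'm) topgroup_scheme \<Rightarrow> ('a, 'g, 'r) bimodule \<Rightarrow> ('b, 'g, 'r) bimodule
    \<Rightarrow> ('c, 'g, 'r) bimodule \<Rightarrow> ('a \<Rightarrow> 'b) \<Rightarrow> ('b \<Rightarrow> 'c)
    \<Rightarrow> (('g \<Rightarrow> 'c) \<times> 'r) set \<Rightarrow> ('g \<times> 'g \<Rightarrow> 'a) set" where
  "delta1 G A B C \<iota> \<pi> X = (\<Union>(\<alpha>, r) \<in> X. \<Union>s \<in> {s. continuous_section B C \<pi> s}.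
     H2_rel G A `` {delta1_cochain G A B \<iota> s \<alpha>})"

section \<open>Exactness of pointed sets\<close>

text \<open>A pointed set is a pair of a set and its base point.\<close>

definition pointed_map :: "'x set \<times> 'x \<Rightarrow> ('x \<Rightarrow> 'y) \<Rightarrow> 'y set \<times> 'y \<Rightarrow> bool" where
  "pointed_map X f Y \<longleftrightarrow> snd X \<in> fst X \<and> snd Y \<in> fst Y \<and> f ` fst X \<subseteq> fst Y \<and> f (snd X) = snd Y"

definition pointed_exact ::
  "'x set \<times> 'x \<Rightarrow> ('x \<Rightarrow> 'y) \<Rightarrow> 'y set \<times> 'y \<Rightarrow> ('y \<Rightarrow> 'z) \<Rightarrow> 'z set \<times> 'z \<Rightarrow> bool" where
  "pointed_exact X f Y g Z \<longleftrightarrow> pointed_map X f Y \<and> pointed_map Y g Z \<and>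
     f ` fst X = {y \<in> fst Y. g y = snd Z}"

definition pH0 :: "('g, 'm) topgroup_scheme \<Rightarrow> ('a, 'g, 'n) gmodule_scheme \<Rightarrow> 'a set \<times> 'a" where
  "pH0 G M = (H0 G M, \<one>\<^bsub>M\<^esub>)"

definition pH1 ::
  "('g, 'm) topgroup_scheme \<Rightarrow> ('a, 'g, 'n) gmodule_scheme
    \<Rightarrow> ('g \<Rightarrow> 'a) set set \<times> ('g \<Rightarrow> 'a) set" where
  "pH1 G M = (H1 G M, H1_rel G M `` {\<lambda>_. \<one>\<^bsub>M\<^esub>})"

definition pH1_pair ::
  "('g, 'm) topgroup_scheme \<Rightarrow> ('r, 'g, 'n) gmodule_scheme \<Rightarrow> ('b, 'g, 'r) bimodule
    \<Rightarrow> (('g \<Rightarrow> 'b) \<times> 'r) set set \<times> (('g \<Rightarrow> 'b) \<times> 'r) set" where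
  "pH1_pair G R B = (H1_pair G R B, Der_rel G R B `` {(\<lambda>_. \<one>\<^bsub>B\<^esub>, \<one>\<^bsub>R\<^esub>)})"

definition pH2 ::
  "('g, 'm) topgroup_scheme \<Rightarrow> ('a, 'g, 'n) gmodule_scheme
    \<Rightarrow> ('g \<times> 'g \<Rightarrow> 'a) set set \<times> ('g \<times> 'g \<Rightarrow> 'a) set" where
  "pH2 G M = (H2 G M, H2_rel G M `` {\<lambda>_. \<one>\<^bsub>M\<^esub>})"

end

theory Submission
  imports Defs
begin

text \<open>
  Since \<open>smap A\<close> is trivial, the Peiffer identity makes \<open>\<iota> ` A\<close> central in \<open>B\<close>, so that the
  classical diagram chases go through on continuous cochains. For a cochain \<open>x\<close> of \<open>B\<close> lying over a
  crossed homomorphism into \<open>C\<close>, the defect \<open>f\<close> given by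
  \<open>x g \<cdot> g (x h) = f (g, h) \<cdot> x (g h)\<close> is a cocycle with values in \<open>A\<close>. Twisting \<open>x\<close>
  by \<open>b\<close> leaves \<open>f\<close> unchanged, and multiplying \<open>x\<close> by \<open>\<iota> \<circ> \<kappa>\<close> changes \<open>f\<close> by the coboundary of
  \<open>\<kappa>\<close>; this gives both the independence of \<open>\<delta>\<^sup>1\<close> from all choices and the lifting of the crossed
  homomorphisms in its kernel. The component in \<open>R\<close> imposes no further condition because
  \<open>smap B = smap C \<circ> \<pi>\<close>.
\<close>

section \<open>Word rewriting in groups and continuity of the operations\<close>

lemma (in group) inv_cancel_left:
  "\<lbrakk>x \<in> carrier G; y \<in> carrier G\<rbrakk> \<Longrightarrow> inv x \<otimes> (x \<otimes> y) = y"
  "\<lbrakk>x \<in> carrier G; y \<in> carrier G\<rbrakk> \<Longrightarrow> x \<otimes> (inv x \<otimes> y) = y"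
  by (simp_all flip: m_assoc)

text \<open>A normal form: products associate to the right, inverses move onto single letters, and
  adjacent inverse pairs cancel.\<close>

lemmas (in group) word_simps = m_assoc inv_mult_group inv_cancel_left

lemma (in topological_group) continuous_map_in_carrier:
  "\<lbrakk>continuous_map X (topo G) f; x \<in> topspace X\<rbrakk> \<Longrightarrow> f x \<in> carrier G"
  using continuous_map_funspace[of X "topo G" f] topspace_topo by auto

lemma (in topological_group) continuous_map_mult:
  assumes "continuous_map X (topo G) f" "continuous_map X (topo G) g"
  shows "continuous_map X (topo G) (\<lambda>x. f x \<otimes> g x)"
proof -
  have "continuous_map X (prod_topology (topo G) (topo G)) (\<lambda>x. (f x, g x))"
    using assms by (simp add: continuous_map_paired)
  from continuous_map_compose[OF this continuous_mult] show ?thesis by (simp add: o_def)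
qed

lemma (in topological_group) continuous_map_inv:
  "continuous_map X (topo G) f \<Longrightarrow> continuous_map X (topo G) (\<lambda>x. inv (f x))"
  using continuous_map_compose[OF _ continuous_inv] by (auto simp: o_def)

lemma (in topological_group) continuous_map_const_carrier:
  "a \<in> carrier G \<Longrightarrow> continuous_map X (topo G) (\<lambda>_. a)"
  by (simp add: topspace_topo)

context topological_module
begin

lemma continuous_map_act:
  assumes "continuous_map X (topo G) f" "continuous_map X (topo A) u"
  shows "continuous_map X (topo A) (\<lambda>x. act (f x) (u x))"
proof -
  have "continuous_map X (prod_topology (topo G) (topo A)) (\<lambda>x. (f x, u x))"
    using assms by (simp add: continuous_map_paired)
  from continuous_map_compose[OF this continuous_act] show ?thesis by (simp add: o_def)
qed

lemma group_hom_act: "g \<in> carrier G \<Longrightarrow> group_hom A A (act g)"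
  using act_auto A.is_group
  by (auto simp: group_hom_def group_hom_axioms_def iso_def)

lemma act_closed [simp]: "\<lbrakk>g \<in> carrier G; a \<in> carrier A\<rbrakk> \<Longrightarrow> act g a \<in> carrier A"
  using group_hom.hom_closed[OF group_hom_act] by blast

lemma act_distrib: "\<lbrakk>g \<in> carrier G; a \<in> carrier A; b \<in> carrier A\<rbrakk>
    \<Longrightarrow> act g (a \<otimes>\<^bsub>A\<^esub> b) = act g a \<otimes>\<^bsub>A\<^esub> act g b"
  using group_hom.hom_mult[OF group_hom_act] by blast

lemma act_inv: "\<lbrakk>g \<in> carrier G; a \<in> carrier A\<rbrakk> \<Longrightarrow> act g (inv\<^bsub>A\<^esub> a) = inv\<^bsub>A\<^esub> (act g a)"
  using group_hom.hom_inv[OF group_hom_act] by blast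

lemma act_unit [simp]: "g \<in> carrier G \<Longrightarrow> act g \<one>\<^bsub>A\<^esub> = \<one>\<^bsub>A\<^esub>"
  using group_hom.hom_one[OF group_hom_act] by blast

lemmas act_simps = act_distrib act_inv act_mult

end

section \<open>Cohomology of a single module\<close>

text \<open>The right action of \<open>M\<close> on its cochains, with action laws
  \<open>twist_one\<close> and \<open>twist_twist\<close>; on crossed homomorphisms its orbit
  relation is \<open>H1_rel\<close>. It is written for arbitrary cochains because
  \<open>lift_cocycle_rel\<close> twists lifts that need not be crossed homomorphisms.\<close>

definition twist ::
  "('a, 'g, 'n) gmodule_scheme \<Rightarrow> 'a \<Rightarrow> ('g \<Rightarrow> 'a) \<Rightarrow> 'g \<Rightarrow> 'a" where
  "twist M m \<alpha> g = inv\<^bsub>M\<^esub> m \<otimes>\<^bsub>M\<^esub> \<alpha> g \<otimes>\<^bsub>M\<^esub> gact M g m"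

locale group_cohomology = topological_module G M "gact M"
  for G :: "('g, 'm) topgroup_scheme" and M :: "('a, 'g, 'n) gmodule_scheme"
begin

lemma H0_closed: "m \<in> H0 G M \<Longrightarrow> m \<in> carrier M"
  by (simp add: H0_def)

lemma H0_one: "\<one>\<^bsub>M\<^esub> \<in> H0 G M"
  by (simp add: H0_def)

lemma H0_mult: "\<lbrakk>m \<in> H0 G M; n \<in> H0 G M\<rbrakk> \<Longrightarrow> m \<otimes>\<^bsub>M\<^esub> n \<in> H0 G M"
  by (simp add: H0_def act_simps)

lemma H0_inv: "m \<in> H0 G M \<Longrightarrow> inv\<^bsub>M\<^esub> m \<in> H0 G M"
  by (simp add: H0_def act_simps)

lemma crossed_homs_closed: "\<lbrakk>\<alpha> \<in> crossed_homs G M; g \<in> carrier G\<rbrakk> \<Longrightarrow> \<alpha> g \<in> carrier M"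
  unfolding crossed_homs_def by (auto intro: A.continuous_map_in_carrier simp: G.topspace_topo)

lemma crossed_homs_cong:
  assumes "\<alpha> \<in> crossed_homs G M" "\<And>g. g \<in> carrier G \<Longrightarrow> \<beta> g = \<alpha> g"
  shows "\<beta> \<in> crossed_homs G M"
  using assms continuous_map_eq[of "topo G" "topo M" \<alpha> \<beta>]
  unfolding crossed_homs_def by (auto simp: G.topspace_topo)

lemma one_crossed_hom: "(\<lambda>_. \<one>\<^bsub>M\<^esub>) \<in> crossed_homs G M"
  unfolding crossed_homs_def by (simp add: A.topspace_topo)

text \<open>In the product on the right, \<open>gact M g m\<close> meets its own inverse between the
  two twisted values and cancels; what remains is the twist of
  \<open>\<alpha> g \<otimes> gact M g (\<alpha> h)\<close>.\<close>

lemma twist_crossed_hom: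
  assumes "m \<in> carrier M" "\<alpha> \<in> crossed_homs G M"
  shows "twist M m \<alpha> \<in> crossed_homs G M"
proof -
  have "continuous_map (topo G) (topo M) (twist M m \<alpha>)"
    using assms unfolding crossed_homs_def twist_def
    by (auto intro!: A.continuous_map_mult continuous_map_act A.continuous_map_const_carrier
        simp: continuous_map_id[unfolded id_def])
  moreover have "twist M m \<alpha> (g \<otimes>\<^bsub>G\<^esub> h) = twist M m \<alpha> g \<otimes>\<^bsub>M\<^esub> gact M g (twist M m \<alpha> h)"
    if "g \<in> carrier G" "h \<in> carrier G" for g h
  proof -
    have "\<alpha> (g \<otimes>\<^bsub>G\<^esub> h) = \<alpha> g \<otimes>\<^bsub>M\<^esub> gact M g (\<alpha> h)"
      using assms that by (auto simp: crossed_homs_def)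
    then show ?thesis
      using assms that crossed_homs_closed[OF assms(2)]
      by (simp add: twist_def A.word_simps act_simps)
  qed
  ultimately show ?thesis by (auto simp: crossed_homs_def)
qed

lemma twist_one: "\<lbrakk>\<alpha> \<in> crossed_homs G M; g \<in> carrier G\<rbrakk> \<Longrightarrow> twist M \<one>\<^bsub>M\<^esub> \<alpha> g = \<alpha> g"
  by (simp add: twist_def crossed_homs_closed)

text \<open>The cochain \<open>\<beta>\<close> is described at the single point \<open>g\<close>
  because related cochains agree with a twist on \<open>carrier G\<close> only.\<close>

lemma twist_twist:
  assumes "m \<in> carrier M" "n \<in> carrier M" "\<alpha> \<in> crossed_homs G M" "g \<in> carrier G"
    and "\<beta> g = twist M m \<alpha> g"
  shows "twist M n \<beta> g = twist M (m \<otimes>\<^bsub>M\<^esub> n) \<alpha> g"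
  using assms crossed_homs_closed[OF assms(3,4)]
  by (simp add: twist_def A.word_simps act_simps)

lemma H1_rel_iff: "(\<alpha>, \<beta>) \<in> H1_rel G M \<longleftrightarrow> \<alpha> \<in> crossed_homs G M \<and> \<beta> \<in> crossed_homs G M \<and>
    (\<exists>m \<in> carrier M. \<forall>g \<in> carrier G. \<beta> g = twist M m \<alpha> g)"
  by (simp add: H1_rel_def twist_def)

lemma untwist:
  assumes "m \<in> carrier M" "\<alpha> \<in> crossed_homs G M" "\<forall>g \<in> carrier G. \<beta> g = twist M m \<alpha> g"
  shows "\<forall>g \<in> carrier G. \<alpha> g = twist M (inv\<^bsub>M\<^esub> m) \<beta> g"
  using assms by (simp add: twist_twist[of m _ \<alpha>] twist_one)

lemma equiv_H1_rel: "equiv (crossed_homs G M) (H1_rel G M)"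
proof (rule equivI)
  show "H1_rel G M \<subseteq> crossed_homs G M \<times> crossed_homs G M"
    by (auto simp: H1_rel_def)
  show "refl_on (crossed_homs G M) (H1_rel G M)"
    by (rule refl_onI) (auto simp: H1_rel_iff twist_one intro!: bexI[of _ "\<one>\<^bsub>M\<^esub>"])
  show "sym (H1_rel G M)"
  proof (rule symI)
    fix \<alpha> \<beta> assume "(\<alpha>, \<beta>) \<in> H1_rel G M"
    then obtain m where m: "m \<in> carrier M" "\<alpha> \<in> crossed_homs G M" "\<beta> \<in> crossed_homs G M"
      "\<forall>g \<in> carrier G. \<beta> g = twist M m \<alpha> g"
      unfolding H1_rel_iff by blast
    then show "(\<beta>, \<alpha>) \<in> H1_rel G M"
      using untwist[OF m(1,2,4)] unfolding H1_rel_iff by (meson A.inv_closed)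
  qed
  show "trans (H1_rel G M)"
  proof (rule transI)
    fix \<alpha> \<beta> \<gamma> assume "(\<alpha>, \<beta>) \<in> H1_rel G M" "(\<beta>, \<gamma>) \<in> H1_rel G M"
    then obtain m n where "m \<in> carrier M" "n \<in> carrier M"
      "\<alpha> \<in> crossed_homs G M" "\<beta> \<in> crossed_homs G M" "\<gamma> \<in> crossed_homs G M"
      "\<forall>g \<in> carrier G. \<beta> g = twist M m \<alpha> g" "\<forall>g \<in> carrier G. \<gamma> g = twist M n \<beta> g"
      unfolding H1_rel_iff by blast
    then show "(\<alpha>, \<gamma>) \<in> H1_rel G M"
      unfolding H1_rel_iff using twist_twist[of m n \<alpha> _ \<beta>] by (auto intro!: bexI[of _ "m \<otimes>\<^bsub>M\<^esub> n"])
  qed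
qed

lemma H1_rel_cong:
  assumes "\<alpha> \<in> crossed_homs G M" "\<And>g. g \<in> carrier G \<Longrightarrow> \<beta> g = \<alpha> g"
  shows "(\<alpha>, \<beta>) \<in> H1_rel G M"
  unfolding H1_rel_iff using assms crossed_homs_cong[OF assms]
  by (auto simp: twist_one intro!: bexI[of _ "\<one>\<^bsub>M\<^esub>"])

lemma cocycles2_closed:
  "\<lbrakk>f \<in> cocycles2 G M; g \<in> carrier G; h \<in> carrier G\<rbrakk> \<Longrightarrow> f (g, h) \<in> carrier M"
  using A.continuous_map_in_carrier[of "prod_topology (topo G) (topo G)" f "(g, h)"]
  by (simp add: cocycles2_def G.topspace_topo)

text \<open>For abelian \<open>M\<close> the coboundary is multiplicative in
  \<open>\<kappa>\<close>, so the trivial cochain, the inverse and the product witness reflexivity,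
  symmetry and transitivity. Commutativity is assumed here and not in the locale, which also serves
  the nonabelian modules.\<close>

lemma equiv_H2_rel:
  assumes comm: "comm_group M"
  shows "equiv (cocycles2 G M) (H2_rel G M)"
proof -
  interpret M: comm_group M by (rule comm)
  have cl: "\<kappa> g \<in> carrier M" if "continuous_map (topo G) (topo M) \<kappa>" "g \<in> carrier G" for \<kappa> g
    using that by (auto intro: A.continuous_map_in_carrier simp: G.topspace_topo)
  show ?thesis
  proof (rule equivI)
    show "H2_rel G M \<subseteq> cocycles2 G M \<times> cocycles2 G M"
      by (auto simp: H2_rel_def)
    show "refl_on (cocycles2 G M) (H2_rel G M)"
      by (rule refl_onI)
        (auto simp: H2_rel_def coboundary2_def cocycles2_closed
          intro!: exI[of _ "\<lambda>_. \<one>\<^bsub>M\<^esub>"] A.continuous_map_const_carrier)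
    show "sym (H2_rel G M)"
    proof (rule symI)
      fix f f' assume "(f, f') \<in> H2_rel G M"
      then obtain \<kappa> where f: "f \<in> cocycles2 G M" "f' \<in> cocycles2 G M"
        and k: "continuous_map (topo G) (topo M) \<kappa>"
        and e: "\<forall>x \<in> carrier G \<times> carrier G. f' x = f x \<otimes>\<^bsub>M\<^esub> coboundary2 G M \<kappa> x"
        unfolding H2_rel_def by blast
      have "f (g, h) = f' (g, h) \<otimes>\<^bsub>M\<^esub> coboundary2 G M (\<lambda>g. inv\<^bsub>M\<^esub> (\<kappa> g)) (g, h)"
        if "g \<in> carrier G" "h \<in> carrier G" for g h
        using that e cl[OF k] cocycles2_closed[OF f(1)]
        by (simp add: coboundary2_def act_simps M.inv_mult M.m_ac A.inv_cancel_left)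
      then show "(f', f) \<in> H2_rel G M"
        using f A.continuous_map_inv[OF k] unfolding H2_rel_def
        by (auto intro!: exI[of _ "\<lambda>g. inv\<^bsub>M\<^esub> (\<kappa> g)"])
    qed
    show "trans (H2_rel G M)"
    proof (rule transI)
      fix f f' f'' assume "(f, f') \<in> H2_rel G M" "(f', f'') \<in> H2_rel G M"
      then obtain \<kappa> \<kappa>' where f: "f \<in> cocycles2 G M" "f'' \<in> cocycles2 G M"
        and k: "continuous_map (topo G) (topo M) \<kappa>" "continuous_map (topo G) (topo M) \<kappa>'"
        and e: "\<forall>x \<in> carrier G \<times> carrier G. f' x = f x \<otimes>\<^bsub>M\<^esub> coboundary2 G M \<kappa> x"
         "\<forall>x \<in> carrier G \<times> carrier G. f'' x = f' x \<otimes>\<^bsub>M\<^esub> coboundary2 G M \<kappa>' x"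
        unfolding H2_rel_def by blast
      have "f'' (g, h) = f (g, h) \<otimes>\<^bsub>M\<^esub> coboundary2 G M (\<lambda>g. \<kappa> g \<otimes>\<^bsub>M\<^esub> \<kappa>' g) (g, h)"
        if "g \<in> carrier G" "h \<in> carrier G" for g h
        using that e cl[OF k(1)] cl[OF k(2)] cocycles2_closed[OF f(1)]
        by (simp add: coboundary2_def act_simps M.inv_mult M.m_ac)
      then show "(f, f'') \<in> H2_rel G M"
        using f A.continuous_map_mult[OF k] unfolding H2_rel_def
        by (auto intro!: exI[of _ "\<lambda>g. \<kappa> g \<otimes>\<^bsub>M\<^esub> \<kappa>' g"])
    qed
  qed
qed

lemma one_cocycle2: "(\<lambda>_. \<one>\<^bsub>M\<^esub>) \<in> cocycles2 G M"
  unfolding cocycles2_def by (simp add: A.topspace_topo)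

end

section \<open>Central kernel of the structure map, and pairs of a crossed homomorphism and an
  element of R\<close>

context partially_crossed_bimodule
begin

sublocale coh: group_cohomology G A
  by unfold_locales

sublocale cohR: group_cohomology G R
  by unfold_locales

sublocale smap: group_hom A R "smap A"
  by (simp add: group_hom_def group_hom_axioms_def RA.mu_hom)

text \<open>The unit lies in the commutator subgroup, so the restricted Peiffer identity applies to
  \<open>a\<close>: conjugation by \<open>a\<close> is the action of \<open>\<one>\<close>, which is
  the identity.\<close>

lemma peiffer_kernel:
  assumes "a \<in> carrier A" "b \<in> carrier A" "smap A a = \<one>\<^bsub>R\<^esub>"
  shows "a \<otimes>\<^bsub>A\<^esub> b = b \<otimes>\<^bsub>A\<^esub> a"
proof -
  have "\<one>\<^bsub>R\<^esub> \<in> derived R (carrier R)"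
    unfolding derived_def by (rule generate.one)
  then have "b = a \<otimes>\<^bsub>A\<^esub> b \<otimes>\<^bsub>A\<^esub> inv\<^bsub>A\<^esub> a"
    using RA.peiffer[OF assms(1,2)] assms RA.act_one by simp
  then show ?thesis
    using assms(1,2) by (metis GA.A.inv_solve_right' GA.A.m_closed)
qed

lemma Der_c_iff: "(\<alpha>, r) \<in> Der_c G R A \<longleftrightarrow> \<alpha> \<in> crossed_homs G A \<and> r \<in> carrier R \<and>
     (\<forall>g \<in> carrier G. smap A (\<alpha> g) = r \<otimes>\<^bsub>R\<^esub> gact R g (inv\<^bsub>R\<^esub> r))"
  by (simp add: Der_c_def)

text \<open>With \<open>t\<close> the new second component, expanding
  \<open>t \<otimes> gact R g (inv t)\<close> makes \<open>z\<close> meet \<open>inv z\<close>,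
  because \<open>z\<close> is fixed by \<open>G\<close>. The rest is the structure map applied to
  the twisted value.\<close>

lemma twist_Der_c:
  assumes "(\<alpha>, r) \<in> Der_c G R A" "b \<in> carrier A" "z \<in> H0 G R"
  shows "(twist A b \<alpha>, inv\<^bsub>R\<^esub> (smap A b) \<otimes>\<^bsub>R\<^esub> r \<otimes>\<^bsub>R\<^esub> z) \<in> Der_c G R A"
proof -
  have a: "\<alpha> \<in> crossed_homs G A" "r \<in> carrier R"
    and e: "\<And>g. g \<in> carrier G \<Longrightarrow> smap A (\<alpha> g) = r \<otimes>\<^bsub>R\<^esub> gact R g (inv\<^bsub>R\<^esub> r)"
    using assms by (auto simp: Der_c_iff)
  have z: "z \<in> carrier R" "\<And>g. g \<in> carrier G \<Longrightarrow> gact R g z = z"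
    using assms by (auto simp: H0_def)
  show ?thesis
    using a z e assms coh.crossed_homs_closed[OF a(1)] coh.twist_crossed_hom[OF assms(2) a(1)]
    by (simp add: Der_c_iff twist_def GR.A.word_simps GR.act_simps smap_gact)
qed

lemma Der_rel_iff: "((\<alpha>, r), (\<beta>, t)) \<in> Der_rel G R A \<longleftrightarrow>
    (\<alpha>, r) \<in> Der_c G R A \<and> (\<beta>, t) \<in> Der_c G R A \<and>
    (\<exists>b \<in> carrier A. (\<forall>g \<in> carrier G. \<beta> g = twist A b \<alpha> g) \<and>
      (\<exists>z \<in> H0 G R. t = inv\<^bsub>R\<^esub> (smap A b) \<otimes>\<^bsub>R\<^esub> r \<otimes>\<^bsub>R\<^esub> z))"
  by (simp add: Der_rel_def twist_def l_coset_def)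

lemma Der_rel_twist:
  assumes "(\<alpha>, r) \<in> Der_c G R A" "b \<in> carrier A" "z \<in> H0 G R"
  shows "((\<alpha>, r), (twist A b \<alpha>, inv\<^bsub>R\<^esub> (smap A b) \<otimes>\<^bsub>R\<^esub> r \<otimes>\<^bsub>R\<^esub> z)) \<in> Der_rel G R A"
  using assms twist_Der_c[OF assms] unfolding Der_rel_iff by blast

lemma Der_rel_cong:
  assumes "(\<alpha>, r) \<in> Der_c G R A" "\<And>g. g \<in> carrier G \<Longrightarrow> \<beta> g = \<alpha> g"
  shows "((\<alpha>, r), (\<beta>, r)) \<in> Der_rel G R A"
proof -
  have "(\<beta>, r) \<in> Der_c G R A"
    using assms coh.crossed_homs_cong[of \<alpha> \<beta>] by (simp add: Der_c_iff)
  then show ?thesis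
    using assms by (auto simp: Der_rel_iff Der_c_iff coh.twist_one
        intro!: bexI[of _ "\<one>\<^bsub>A\<^esub>"] bexI[of _ "\<one>\<^bsub>R\<^esub>"] cohR.H0_one)
qed

text \<open>The pairs \<open>(b, z)\<close> act from the right: \<open>b\<close> twists the cochain
  and multiplies \<open>r\<close> on the left by the inverse of \<open>smap A b\<close>, while
  \<open>z\<close> multiplies \<open>r\<close> on the right. The two multiplications commute, so
  \<open>(inv b, inv z)\<close> and \<open>(b \<otimes> b', z \<otimes> z')\<close> are the
  witnesses for symmetry and transitivity.\<close>

lemma equiv_Der_rel: "equiv (Der_c G R A) (Der_rel G R A)"
proof (rule equivI)
  show "Der_rel G R A \<subseteq> Der_c G R A \<times> Der_c G R A"
    by (auto simp: Der_rel_def)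
  show "refl_on (Der_c G R A) (Der_rel G R A)"
  proof (rule refl_onI)
    fix x assume "x \<in> Der_c G R A"
    then show "(x, x) \<in> Der_rel G R A"
      by (cases x) (auto simp: Der_rel_iff Der_c_iff coh.twist_one
          intro!: bexI[of _ "\<one>\<^bsub>A\<^esub>"] bexI[of _ "\<one>\<^bsub>R\<^esub>"] cohR.H0_one)
  qed
  show "sym (Der_rel G R A)"
  proof (rule symI)
    fix x y assume xy: "(x, y) \<in> Der_rel G R A"
    obtain \<alpha> r \<beta> t where [simp]: "x = (\<alpha>, r)" "y = (\<beta>, t)" by (cases x, cases y) auto
    obtain b z where d: "(\<alpha>, r) \<in> Der_c G R A" "(\<beta>, t) \<in> Der_c G R A"
      and b: "b \<in> carrier A" "\<forall>g \<in> carrier G. \<beta> g = twist A b \<alpha> g"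
      and z: "z \<in> H0 G R" "t = inv\<^bsub>R\<^esub> (smap A b) \<otimes>\<^bsub>R\<^esub> r \<otimes>\<^bsub>R\<^esub> z"
      using xy by (simp add: Der_rel_iff) blast
    have "\<alpha> \<in> crossed_homs G A" "r \<in> carrier R"
      using d by (auto simp: Der_c_iff)
    then have "r = inv\<^bsub>R\<^esub> (smap A (inv\<^bsub>A\<^esub> b)) \<otimes>\<^bsub>R\<^esub> t \<otimes>\<^bsub>R\<^esub> inv\<^bsub>R\<^esub> z"
      and "\<forall>g \<in> carrier G. \<alpha> g = twist A (inv\<^bsub>A\<^esub> b) \<beta> g"
      using b z cohR.H0_closed[OF z(1)] coh.untwist[OF b(1) _ b(2)]
      by (simp_all add: GR.A.word_simps)
    then have "((\<beta>, t), (\<alpha>, r)) \<in> Der_rel G R A"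
      unfolding Der_rel_iff using d cohR.H0_inv[OF z(1)] GA.A.inv_closed[OF b(1)] by blast
    then show "(y, x) \<in> Der_rel G R A" by simp
  qed
  show "trans (Der_rel G R A)"
  proof (rule transI)
    fix x y w assume xy: "(x, y) \<in> Der_rel G R A" "(y, w) \<in> Der_rel G R A"
    obtain \<alpha> r \<beta> t \<gamma> u where [simp]: "x = (\<alpha>, r)" "y = (\<beta>, t)" "w = (\<gamma>, u)"
      by (cases x, cases y, cases w) auto
    obtain b z b' z' where d: "(\<alpha>, r) \<in> Der_c G R A" "(\<gamma>, u) \<in> Der_c G R A"
      and b: "b \<in> carrier A" "\<forall>g \<in> carrier G. \<beta> g = twist A b \<alpha> g"
      and z: "z \<in> H0 G R" "t = inv\<^bsub>R\<^esub> (smap A b) \<otimes>\<^bsub>R\<^esub> r \<otimes>\<^bsub>R\<^esub> z"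
      and b': "b' \<in> carrier A" "\<forall>g \<in> carrier G. \<gamma> g = twist A b' \<beta> g"
      and z': "z' \<in> H0 G R" "u = inv\<^bsub>R\<^esub> (smap A b') \<otimes>\<^bsub>R\<^esub> t \<otimes>\<^bsub>R\<^esub> z'"
      using xy by (simp add: Der_rel_iff) blast
    have "\<alpha> \<in> crossed_homs G A" "r \<in> carrier R"
      using d by (auto simp: Der_c_iff)
    then have "u = inv\<^bsub>R\<^esub> (smap A (b \<otimes>\<^bsub>A\<^esub> b')) \<otimes>\<^bsub>R\<^esub> r \<otimes>\<^bsub>R\<^esub> (z \<otimes>\<^bsub>R\<^esub> z')"
      and "\<forall>g \<in> carrier G. \<gamma> g = twist A (b \<otimes>\<^bsub>A\<^esub> b') \<alpha> g"
      using b z b' z' cohR.H0_closed coh.twist_twist[of b b' \<alpha> _ \<beta>]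
      by (simp_all add: GR.A.word_simps)
    then have "((\<alpha>, r), (\<gamma>, u)) \<in> Der_rel G R A"
      unfolding Der_rel_iff
      using d cohR.H0_mult[OF z(1) z'(1)] GA.A.m_closed[OF b(1) b'(1)] by blast
    then show "(x, w) \<in> Der_rel G R A" by simp
  qed
qed

lemma one_Der_c: "(\<lambda>_. \<one>\<^bsub>A\<^esub>, \<one>\<^bsub>R\<^esub>) \<in> Der_c G R A"
  by (simp add: Der_c_iff coh.one_crossed_hom)

end


section \<open>Functoriality of cochains and relations under morphisms\<close>

context bimodule_morphism
begin

sublocale hom: group_hom A B f
  by (simp add: group_hom_def group_hom_axioms_def f_hom)

lemma H0_image: "m \<in> H0 G A \<Longrightarrow> f m \<in> H0 G B"
  by (simp add: H0_def flip: f_gact)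

lemma crossed_hom_image: "\<alpha> \<in> crossed_homs G A \<Longrightarrow> f \<circ> \<alpha> \<in> crossed_homs G B"
  using A.coh.crossed_homs_closed[of \<alpha>]
  by (auto simp: crossed_homs_def f_gact intro: continuous_map_compose[OF _ continuous_f])

lemma twist_image:
  "\<lbrakk>m \<in> carrier A; \<alpha> \<in> crossed_homs G A; g \<in> carrier G\<rbrakk>
    \<Longrightarrow> f (twist A m \<alpha> g) = twist B (f m) (f \<circ> \<alpha>) g"
  using A.coh.crossed_homs_closed[of \<alpha>] by (simp add: twist_def f_gact)

lemma Der_c_image: "(\<alpha>, r) \<in> Der_c G R A \<Longrightarrow> (f \<circ> \<alpha>, r) \<in> Der_c G R B"
  using A.coh.crossed_homs_closed[of \<alpha>]
  by (simp add: A.Der_c_iff B.Der_c_iff crossed_hom_image smap_f)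

text \<open>A morphism commutes with the structure maps, so twisting by \<open>f b\<close> moves
  \<open>r\<close> exactly as twisting by \<open>b\<close> does, and the same \<open>z\<close>
  serves.\<close>

lemma Der_rel_image:
  assumes "((\<alpha>, r), (\<beta>, t)) \<in> Der_rel G R A"
  shows "((f \<circ> \<alpha>, r), (f \<circ> \<beta>, t)) \<in> Der_rel G R B"
proof -
  obtain b z where d: "(\<alpha>, r) \<in> Der_c G R A" "(\<beta>, t) \<in> Der_c G R A"
    and b: "b \<in> carrier A" "\<forall>g \<in> carrier G. \<beta> g = twist A b \<alpha> g"
    and z: "z \<in> H0 G R" "t = inv\<^bsub>R\<^esub> (smap A b) \<otimes>\<^bsub>R\<^esub> r \<otimes>\<^bsub>R\<^esub> z"
    using assms unfolding A.Der_rel_iff by blast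
  have "\<forall>g \<in> carrier G. (f \<circ> \<beta>) g = twist B (f b) (f \<circ> \<alpha>) g"
    using d b by (simp add: A.Der_c_iff twist_image)
  moreover have "t = inv\<^bsub>R\<^esub> (smap B (f b)) \<otimes>\<^bsub>R\<^esub> r \<otimes>\<^bsub>R\<^esub> z"
    using z b by (simp add: smap_f)
  ultimately show ?thesis
    unfolding B.Der_rel_iff using Der_c_image[OF d(1)] Der_c_image[OF d(2)] z(1)
      hom.hom_closed[OF b(1)] by blast
qed

end

section \<open>The exact sequence\<close>

text \<open>The word computation behind \<open>lift_cocycle_rel\<close>, freed from actions. There
  \<open>p\<close>, \<open>q\<close>, \<open>r\<close> are \<open>x g\<close>,
  \<open>gact B g (x h)\<close>, \<open>x (g \<otimes> h)\<close>; the letters \<open>b\<close>,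
  \<open>c\<close>, \<open>d\<close> are the inverse of the twisting element and its images under
  \<open>g\<close> and \<open>g \<otimes> h\<close>; \<open>F\<close> is the defect of
  \<open>x\<close>, and \<open>K\<close>, \<open>L\<close>, \<open>M\<close> come from the
  correcting cochain \<open>\<kappa>\<close>. The factor
  \<open>L \<otimes> inv M \<otimes> K\<close> is its coboundary.\<close>

lemma (in group) central_twist:
  assumes car: "b \<in> carrier G" "c \<in> carrier G" "d \<in> carrier G"
      "p \<in> carrier G" "q \<in> carrier G" "r \<in> carrier G"
      "F \<in> carrier G" "K \<in> carrier G" "L \<in> carrier G" "M \<in> carrier G"
    and central: "\<And>z. z \<in> carrier G \<Longrightarrow> F \<otimes> z = z \<otimes> F"
      "\<And>z. z \<in> carrier G \<Longrightarrow> K \<otimes> z = z \<otimes> K"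
      "\<And>z. z \<in> carrier G \<Longrightarrow> L \<otimes> z = z \<otimes> L"
      "\<And>z. z \<in> carrier G \<Longrightarrow> M \<otimes> z = z \<otimes> M"
    and pq: "p \<otimes> q = F \<otimes> r"
  shows "(b \<otimes> p \<otimes> c \<otimes> K) \<otimes> (inv c \<otimes> q \<otimes> d \<otimes> L)
    = (F \<otimes> (L \<otimes> inv M \<otimes> K)) \<otimes> (b \<otimes> r \<otimes> d \<otimes> M)"
proof -
  have "(b \<otimes> p \<otimes> c \<otimes> K) \<otimes> (inv c \<otimes> q \<otimes> d \<otimes> L)
      = b \<otimes> p \<otimes> c \<otimes> (K \<otimes> (inv c \<otimes> q \<otimes> d \<otimes> L))"
    using car by (simp add: m_assoc)
  also have "\<dots> = b \<otimes> p \<otimes> c \<otimes> ((inv c \<otimes> q \<otimes> d \<otimes> L) \<otimes> K)"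
    using car central(2)[of "inv c \<otimes> q \<otimes> d \<otimes> L"] by simp
  also have "\<dots> = b \<otimes> (p \<otimes> q) \<otimes> d \<otimes> (L \<otimes> K)"
    using car by (simp add: word_simps)
  also have "\<dots> = (b \<otimes> F) \<otimes> (r \<otimes> d \<otimes> (L \<otimes> K))"
    using car by (simp add: pq m_assoc)
  also have "\<dots> = (F \<otimes> b) \<otimes> (r \<otimes> d \<otimes> (L \<otimes> K))"
    using car central(1)[of b] by simp
  finally have l: "(b \<otimes> p \<otimes> c \<otimes> K) \<otimes> (inv c \<otimes> q \<otimes> d \<otimes> L) = F \<otimes> ((b \<otimes> r \<otimes> d) \<otimes> (L \<otimes> K))"
    using car by (simp add: m_assoc)
  \<comment> \<open>The noncentral word is kept as one letter while the central ones are moved past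
    it.\<close>
  define w where "w = b \<otimes> r \<otimes> d"
  have w: "w \<in> carrier G" using car by (simp add: w_def)
  have "(L \<otimes> inv M \<otimes> K) \<otimes> (w \<otimes> M) = L \<otimes> (inv M \<otimes> (K \<otimes> (w \<otimes> M)))"
    using car w by (simp add: m_assoc)
  also have "\<dots> = L \<otimes> (inv M \<otimes> (M \<otimes> (w \<otimes> K)))"
    using car w central(2)[of "w \<otimes> M"] central(4)[of "w \<otimes> K"] central(4)[of K] by (simp add: m_assoc)
  also have "\<dots> = w \<otimes> (L \<otimes> K)"
    using car w central(3)[of "w \<otimes> K"] central(3)[of K] by (simp add: word_simps)
  finally show ?thesis
    using l car by (simp add: w_def m_assoc)
qed

text \<open>
  Unlike \<open>delta1_cochain\<close>, this takes an arbitrary cochain \<open>x\<close> of \<open>B\<close>, which need not come from a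
  section: taking for \<open>x\<close> a crossed homomorphism gives the trivial cocycle.
\<close>

definition lift_cocycle ::
  "('g, 'm) topgroup_scheme \<Rightarrow> ('a, 'g, 'r) bimodule \<Rightarrow> ('b, 'g, 'r) bimodule
    \<Rightarrow> ('a \<Rightarrow> 'b) \<Rightarrow> ('g \<Rightarrow> 'b) \<Rightarrow> 'g \<times> 'g \<Rightarrow> 'a" where
  "lift_cocycle G A B \<iota> x = (\<lambda>(g, h). inv_into (carrier A) \<iota>
     (x g \<otimes>\<^bsub>B\<^esub> gact B g (x h) \<otimes>\<^bsub>B\<^esub> inv\<^bsub>B\<^esub> (x (g \<otimes>\<^bsub>G\<^esub> h))))"

section \<open>Kernel, centrality and lifting in the extension\<close>

context proper_extension
begin

abbreviation iota_inv :: "'b \<Rightarrow> 'a" where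
  "iota_inv \<equiv> inv_into (carrier A) \<iota>"

lemma iota_inv_iota [simp]: "a \<in> carrier A \<Longrightarrow> iota_inv (\<iota> a) = a"
  using iota_inj by simp

lemma iota_eqD: "\<lbrakk>\<iota> a = \<iota> a'; a \<in> carrier A; a' \<in> carrier A\<rbrakk> \<Longrightarrow> a = a'"
  using iota_inj by (simp add: inj_on_def)

lemma pi_iota [simp]: "a \<in> carrier A \<Longrightarrow> \<pi> (\<iota> a) = \<one>\<^bsub>C\<^esub>"
  using exact_middle by (auto simp: kernel_def)

lemma iota_iota_inv:
  assumes "b \<in> carrier B" "\<pi> b = \<one>\<^bsub>C\<^esub>"
  shows "iota_inv b \<in> carrier A" "\<iota> (iota_inv b) = b"
proof -
  have "b \<in> \<iota> ` carrier A"
    using assms exact_middle by (simp add: kernel_def)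
  then show "iota_inv b \<in> carrier A" "\<iota> (iota_inv b) = b"
    by (simp_all add: inv_into_into f_inv_into_f)
qed

text \<open>Exactness puts the values of \<open>u\<close> into the image of \<open>\<iota>\<close>,
  and the embedding hypothesis makes the inverse continuous on that image.\<close>

lemma continuous_map_iota_inv:
  assumes "continuous_map X (topo B) u" "\<And>x. x \<in> topspace X \<Longrightarrow> \<pi> (u x) = \<one>\<^bsub>C\<^esub>"
  shows "continuous_map X (topo A) (\<lambda>x. iota_inv (u x))"
proof -
  let ?S = "subtopology (topo B) (\<iota> ` topspace (topo A))"
  have tA: "topspace (topo A) = carrier A"
    by (rule iota.A.GA.A.topspace_topo)
  obtain v where v: "homeomorphic_maps (topo A) ?S \<iota> v"
    using iota_embedding by (auto simp: embedding_map_def homeomorphic_map_maps)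
  have u: "u x \<in> carrier B" "u x = \<iota> (iota_inv (u x))" "iota_inv (u x) \<in> carrier A"
    if "x \<in> topspace X" for x
    using that assms iota.B.GA.A.continuous_map_in_carrier[OF assms(1)] iota_iota_inv by auto
  have "continuous_map X ?S u"
    using assms(1) u by (auto simp: continuous_map_in_subtopology tA)
  then have "continuous_map X (topo A) (v \<circ> u)"
    using v by (auto simp: homeomorphic_maps_def intro: continuous_map_compose)
  \<comment> \<open>Both \<open>v\<close> and \<open>iota_inv\<close> invert \<open>\<iota>\<close>
    on its image, so they agree at the values of \<open>u\<close>.\<close>
  moreover have "(v \<circ> u) x = iota_inv (u x)" if "x \<in> topspace X" for x
    using v u[OF that] tA by (simp add: homeomorphic_maps_def) metis
  ultimately show ?thesis by (rule continuous_map_eq)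
qed

lemma iota_central:
  "\<lbrakk>a \<in> carrier A; b \<in> carrier B\<rbrakk> \<Longrightarrow> \<iota> a \<otimes>\<^bsub>B\<^esub> b = b \<otimes>\<^bsub>B\<^esub> \<iota> a"
  by (rule iota.B.peiffer_kernel) (simp_all add: iota.smap_f smap_A)

lemma comm_group_A: "comm_group A"
  by (rule iota.A.GA.A.group_comm_groupI) (simp add: iota.A.peiffer_kernel smap_A)

lemmas equivs = iota.A.coh.equiv_H1_rel iota.B.equiv_Der_rel pi.B.equiv_Der_rel
  iota.A.coh.equiv_H2_rel[OF comm_group_A]

lemma pi_lift: "c \<in> carrier C \<Longrightarrow> \<exists>b \<in> carrier B. \<pi> b = c"
  using pi_surj by (metis imageE)

lemma pi_eq_cancel:
  "\<lbrakk>b \<in> carrier B; b' \<in> carrier B; \<pi> b = \<pi> b'\<rbrakk> \<Longrightarrow> \<pi> (inv\<^bsub>B\<^esub> b \<otimes>\<^bsub>B\<^esub> b') = \<one>\<^bsub>C\<^esub>"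
  by simp

text \<open>The crossed identity is checked after applying the injective equivariant
  \<open>\<iota>\<close>, where it is the one for \<open>\<beta>\<close>. This produces the classes
  in \<open>H1 G A\<close> both for \<open>delta0\<close> and for exactness at
  \<open>H1_pair G R B\<close>.\<close>

lemma crossed_hom_iota_inv:
  assumes "\<beta> \<in> crossed_homs G B" "\<And>g. g \<in> carrier G \<Longrightarrow> \<pi> (\<beta> g) = \<one>\<^bsub>C\<^esub>"
  shows "(\<lambda>g. iota_inv (\<beta> g)) \<in> crossed_homs G A"
    and "\<And>g. g \<in> carrier G \<Longrightarrow> \<iota> (iota_inv (\<beta> g)) = \<beta> g"
proof -
  have cl: "\<beta> g \<in> carrier B" "iota_inv (\<beta> g) \<in> carrier A" "\<iota> (iota_inv (\<beta> g)) = \<beta> g"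
    if "g \<in> carrier G" for g
    using that assms iota.B.coh.crossed_homs_closed iota_iota_inv by auto
  have "continuous_map (topo G) (topo A) (\<lambda>g. iota_inv (\<beta> g))"
    using assms by (intro continuous_map_iota_inv)
      (auto simp: crossed_homs_def iota.A.GR.G.topspace_topo)
  moreover have "iota_inv (\<beta> (g \<otimes>\<^bsub>G\<^esub> h)) = iota_inv (\<beta> g) \<otimes>\<^bsub>A\<^esub> gact A g (iota_inv (\<beta> h))"
    if "g \<in> carrier G" "h \<in> carrier G" for g h
  proof (rule iota_eqD)
    have "\<iota> (iota_inv (\<beta> (g \<otimes>\<^bsub>G\<^esub> h))) = \<beta> g \<otimes>\<^bsub>B\<^esub> gact B g (\<beta> h)"
      unfolding cl(3)[OF iota.A.GR.G.m_closed[OF that]]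
      using that assms(1) by (simp add: crossed_homs_def)
    also have "\<dots> = \<iota> (iota_inv (\<beta> g) \<otimes>\<^bsub>A\<^esub> gact A g (iota_inv (\<beta> h)))"
      using that cl by (simp add: iota.f_gact)
    finally show "\<iota> (iota_inv (\<beta> (g \<otimes>\<^bsub>G\<^esub> h))) = \<iota> (iota_inv (\<beta> g) \<otimes>\<^bsub>A\<^esub> gact A g (iota_inv (\<beta> h)))" .
  qed (use that cl in auto)
  ultimately show "(\<lambda>g. iota_inv (\<beta> g)) \<in> crossed_homs G A"
    by (simp add: crossed_homs_def)
  show "\<And>g. g \<in> carrier G \<Longrightarrow> \<iota> (iota_inv (\<beta> g)) = \<beta> g"
    by (rule cl)
qed

text \<open>Moves the relation into B, where the lifts \<open>b\<close> live and words can be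
  computed; injectivity of \<open>\<iota>\<close> brings the equation back to A.\<close>

lemma H1_rel_A_iff:
  assumes "\<alpha> \<in> crossed_homs G A" "\<beta> \<in> crossed_homs G A"
  shows "(\<alpha>, \<beta>) \<in> H1_rel G A \<longleftrightarrow>
    (\<exists>a \<in> carrier A. \<forall>g \<in> carrier G. \<iota> (\<beta> g) = twist B (\<iota> a) (\<iota> \<circ> \<alpha>) g)"
proof -
  have "\<beta> g = twist A a \<alpha> g \<longleftrightarrow> \<iota> (\<beta> g) = twist B (\<iota> a) (\<iota> \<circ> \<alpha>) g"
    if "a \<in> carrier A" "g \<in> carrier G" for a g
    using that assms iota_eqD[of "\<beta> g" "twist A a \<alpha> g"] iota.A.coh.crossed_homs_closed
      iota.A.coh.twist_crossed_hom[of a \<alpha>]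
    by (metis iota.twist_image)
  then show ?thesis
    using assms unfolding iota.A.coh.H1_rel_iff by blast
qed

subsection \<open>The maps on classes\<close>

text \<open>The cochain is the twist of the trivial crossed homomorphism by \<open>b\<close>, hence
  crossed itself. Its image in C is trivial because \<open>\<pi> b\<close> is invariant.\<close>

lemma connecting_crossed_hom:
  assumes "b \<in> carrier B" "\<pi> b \<in> H0 G C"
  shows "(\<lambda>g. iota_inv (inv\<^bsub>B\<^esub> b \<otimes>\<^bsub>B\<^esub> gact B g b)) \<in> crossed_homs G A"
    and "\<And>g. g \<in> carrier G \<Longrightarrow>
      \<iota> (iota_inv (inv\<^bsub>B\<^esub> b \<otimes>\<^bsub>B\<^esub> gact B g b)) = inv\<^bsub>B\<^esub> b \<otimes>\<^bsub>B\<^esub> gact B g b"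
proof -
  let ?\<beta> = "\<lambda>g. inv\<^bsub>B\<^esub> b \<otimes>\<^bsub>B\<^esub> gact B g b"
  have "?\<beta> \<in> crossed_homs G B"
    using iota.B.coh.twist_crossed_hom[OF assms(1) iota.B.coh.one_crossed_hom] assms(1)
    by (auto elim!: iota.B.coh.crossed_homs_cong simp: twist_def)
  moreover have "\<pi> (?\<beta> g) = \<one>\<^bsub>C\<^esub>" if "g \<in> carrier G" for g
    using that assms by (simp add: pi.f_gact H0_def)
  ultimately show "(\<lambda>g. iota_inv (?\<beta> g)) \<in> crossed_homs G A"
    and "\<And>g. g \<in> carrier G \<Longrightarrow> \<iota> (iota_inv (?\<beta> g)) = ?\<beta> g"
    using crossed_hom_iota_inv[of ?\<beta>] by auto
qed

text \<open>Two lifts of the same element satisfy \<open>b' = b \<otimes> \<iota> a\<close>, and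
  replacing \<open>b\<close> by \<open>b'\<close> twists the cochain by \<open>\<iota> a\<close>. So
  all classes in the union defining \<open>delta0\<close> coincide.\<close>

lemma delta0_eq:
  assumes "b \<in> carrier B" "\<pi> b \<in> H0 G C"
  shows "delta0 G A B \<iota> \<pi> (\<pi> b)
    = H1_rel G A `` {\<lambda>g. iota_inv (inv\<^bsub>B\<^esub> b \<otimes>\<^bsub>B\<^esub> gact B g b)}"
proof -
  let ?d = "\<lambda>b g. iota_inv (inv\<^bsub>B\<^esub> b \<otimes>\<^bsub>B\<^esub> gact B g b)"
  have "(?d b, ?d b') \<in> H1_rel G A" if b': "b' \<in> carrier B" "\<pi> b' = \<pi> b" for b'
  proof -
    obtain a where a: "a \<in> carrier A" "\<iota> a = inv\<^bsub>B\<^esub> b \<otimes>\<^bsub>B\<^esub> b'"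
      using iota_iota_inv[of "inv\<^bsub>B\<^esub> b \<otimes>\<^bsub>B\<^esub> b'"] assms b' by auto
    have "\<iota> (?d b' g) = twist B (\<iota> a) (\<iota> \<circ> ?d b) g" if "g \<in> carrier G" for g
      using that assms b' a connecting_crossed_hom(2)[of b g] connecting_crossed_hom(2)[of b' g]
      by (simp add: twist_def iota.B.GA.A.word_simps iota.B.GA.act_simps)
    then show ?thesis
      using assms b' a(1) connecting_crossed_hom(1)[of b] connecting_crossed_hom(1)[of b']
      by (subst H1_rel_A_iff) (auto intro!: bexI[of _ a])
  qed
  then have "H1_rel G A `` {?d b'} = H1_rel G A `` {?d b}"
    if "b' \<in> carrier B" "\<pi> b' = \<pi> b" for b'
    using that equiv_class_eq[OF equivs(1)] by metis
  then show ?thesis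
    unfolding delta0_def using assms(1) by blast
qed

lemma A_Der_c: "\<alpha> \<in> crossed_homs G A \<Longrightarrow> (\<alpha>, \<one>\<^bsub>R\<^esub>) \<in> Der_c G R A"
  using iota.A.coh.crossed_homs_closed by (simp add: iota.A.Der_c_iff smap_A)

text \<open>The union collapses once its terms are constant on the class. A twist by
  \<open>a\<close> leaves the second component at \<open>\<one>\<close> because
  \<open>smap A\<close> is trivial, and \<open>\<iota>\<close> preserves the relation on
  pairs.\<close>

lemma iota1_eq:
  assumes "\<alpha> \<in> crossed_homs G A"
  shows "iota1 G R B \<iota> (H1_rel G A `` {\<alpha>}) = Der_rel G R B `` {(\<iota> \<circ> \<alpha>, \<one>\<^bsub>R\<^esub>)}"
  unfolding iota1_def
proof (rule UN_equiv_class[OF equivs(1) _ assms], rule congruentI)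
  fix \<alpha> \<beta> assume r: "(\<alpha>, \<beta>) \<in> H1_rel G A"
  then obtain a where a: "\<alpha> \<in> crossed_homs G A" "\<beta> \<in> crossed_homs G A" "a \<in> carrier A"
    "\<forall>g \<in> carrier G. \<beta> g = twist A a \<alpha> g"
    unfolding iota.A.coh.H1_rel_iff by blast
  have "((\<alpha>, \<one>\<^bsub>R\<^esub>), (\<beta>, \<one>\<^bsub>R\<^esub>)) \<in> Der_rel G R A"
    unfolding iota.A.Der_rel_iff
    using a(3,4) A_Der_c[OF a(1)] A_Der_c[OF a(2)]
    by (auto simp: smap_A intro!: bexI[of _ a] bexI[of _ "\<one>\<^bsub>R\<^esub>"] iota.A.cohR.H0_one)
  then show "Der_rel G R B `` {(\<iota> \<circ> \<alpha>, \<one>\<^bsub>R\<^esub>)} = Der_rel G R B `` {(\<iota> \<circ> \<beta>, \<one>\<^bsub>R\<^esub>)}"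
    by (intro equiv_class_eq[OF equivs(2)] iota.Der_rel_image)
qed

lemma pi1_eq:
  assumes "(\<beta>, r) \<in> Der_c G R B"
  shows "pi1 G R C \<pi> (Der_rel G R B `` {(\<beta>, r)}) = Der_rel G R C `` {(\<pi> \<circ> \<beta>, r)}"
proof -
  have "(\<lambda>(\<beta>, r). Der_rel G R C `` {(\<pi> \<circ> \<beta>, r)}) respects Der_rel G R B"
    by (rule congruentI) (auto intro!: equiv_class_eq[OF equivs(3)] pi.Der_rel_image)
  from UN_equiv_class[OF equivs(2) this assms] show ?thesis
    by (simp add: pi1_def)
qed

section \<open>Defect cocycles of lifts and the second connecting map\<close>

lemma cochain_closed:
  "\<lbrakk>continuous_map (topo G) (topo B) x; g \<in> carrier G\<rbrakk> \<Longrightarrow> x g \<in> carrier B"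
  using iota.B.GA.A.continuous_map_in_carrier[of "topo G" x g] by (simp add: iota.A.GR.G.topspace_topo)

text \<open>Since \<open>\<pi> \<circ> x\<close> is crossed, the defect of \<open>x\<close> lies in
  the kernel of \<open>\<pi>\<close>, that is, in A. The cocycle law is associativity applied to
  \<open>x g\<close>, \<open>gact B g (x h)\<close> and \<open>gact B (g \<otimes> h) (x k)\<close>.
  The second claim characterises the defect and spares later proofs the inverse of
  \<open>\<iota>\<close>.\<close>

lemma lift_cocycle_cocycle:
  assumes x: "continuous_map (topo G) (topo B) x" and c: "\<pi> \<circ> x \<in> crossed_homs G C"
  shows "lift_cocycle G A B \<iota> x \<in> cocycles2 G A"
    and "\<lbrakk>g \<in> carrier G; h \<in> carrier G\<rbrakk> \<Longrightarrow> x g \<otimes>\<^bsub>B\<^esub> gact B g (x h)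
      = \<iota> (lift_cocycle G A B \<iota> x (g, h)) \<otimes>\<^bsub>B\<^esub> x (g \<otimes>\<^bsub>G\<^esub> h)"
proof -
  let ?f = "lift_cocycle G A B \<iota> x"
  let ?u = "\<lambda>(g, h). x g \<otimes>\<^bsub>B\<^esub> gact B g (x h) \<otimes>\<^bsub>B\<^esub> inv\<^bsub>B\<^esub> (x (g \<otimes>\<^bsub>G\<^esub> h))"
  have xc: "x g \<in> carrier B" if "g \<in> carrier G" for g
    using that cochain_closed[OF x] by blast
  have u: "\<pi> (?u (g, h)) = \<one>\<^bsub>C\<^esub>" if "g \<in> carrier G" "h \<in> carrier G" for g h
  proof -
    have "\<pi> (x (g \<otimes>\<^bsub>G\<^esub> h)) = \<pi> (x g) \<otimes>\<^bsub>C\<^esub> gact C g (\<pi> (x h))"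
      using that c by (simp add: crossed_homs_def)
    then show ?thesis
      using that xc by (simp add: pi.f_gact)
  qed
  have f: "?f (g, h) \<in> carrier A" "\<iota> (?f (g, h)) = ?u (g, h)"
    if "g \<in> carrier G" "h \<in> carrier G" for g h
    using that iota_iota_inv[OF _ u[OF that]] xc by (simp_all add: lift_cocycle_def)
  have fx: "x g \<otimes>\<^bsub>B\<^esub> gact B g (x h) = \<iota> (?f (g, h)) \<otimes>\<^bsub>B\<^esub> x (g \<otimes>\<^bsub>G\<^esub> h)"
    if "g \<in> carrier G" "h \<in> carrier G" for g h
    using that xc by (simp add: f iota.B.GA.A.word_simps)
  then show "\<lbrakk>g \<in> carrier G; h \<in> carrier G\<rbrakk> \<Longrightarrow> x g \<otimes>\<^bsub>B\<^esub> gact B g (x h)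
      = \<iota> (lift_cocycle G A B \<iota> x (g, h)) \<otimes>\<^bsub>B\<^esub> x (g \<otimes>\<^bsub>G\<^esub> h)" .
  have "continuous_map (prod_topology (topo G) (topo G)) (topo B) ?u"
  proof -
    have p: "continuous_map (prod_topology (topo G) (topo G)) (topo G) fst"
      "continuous_map (prod_topology (topo G) (topo G)) (topo G) snd"
      by (rule continuous_map_fst continuous_map_snd)+
    show ?thesis
      unfolding case_prod_beta
      using continuous_map_compose[OF p(1) x] continuous_map_compose[OF p(2) x]
        continuous_map_compose[OF iota.A.GR.G.continuous_map_mult[OF p] x] p(1)
      by (intro iota.B.GA.A.continuous_map_mult iota.B.GA.continuous_map_act
          iota.B.GA.A.continuous_map_inv) (simp_all add: o_def)
  qed
  then have "continuous_map (prod_topology (topo G) (topo G)) (topo A) (\<lambda>p. iota_inv (?u p))"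
    using u by (intro continuous_map_iota_inv) (auto simp: iota.A.GR.G.topspace_topo)
  then have cont: "continuous_map (prod_topology (topo G) (topo G)) (topo A) ?f"
    by (simp add: lift_cocycle_def case_prod_unfold)
  have "gact A g (?f (h, k)) \<otimes>\<^bsub>A\<^esub> ?f (g, h \<otimes>\<^bsub>G\<^esub> k) = ?f (g \<otimes>\<^bsub>G\<^esub> h, k) \<otimes>\<^bsub>A\<^esub> ?f (g, h)"
    (is "?l = ?r") if G: "g \<in> carrier G" "h \<in> carrier G" "k \<in> carrier G" for g h k
  proof (rule iota_eqD)
    \<comment> \<open>Both sides are multiplied by \<open>?w\<close>, so that \<open>fx\<close> can
      absorb or release one value of \<open>?f\<close> at a time; \<open>?w\<close> is cancelled at
      the end. Centrality moves the value at \<open>(h, k)\<close> past \<open>x g\<close>.\<close>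
    let ?w = "x (g \<otimes>\<^bsub>G\<^esub> h \<otimes>\<^bsub>G\<^esub> k)"
    have "\<iota> ?l \<otimes>\<^bsub>B\<^esub> ?w = gact B g (\<iota> (?f (h, k))) \<otimes>\<^bsub>B\<^esub> (\<iota> (?f (g, h \<otimes>\<^bsub>G\<^esub> k)) \<otimes>\<^bsub>B\<^esub> x (g \<otimes>\<^bsub>G\<^esub> (h \<otimes>\<^bsub>G\<^esub> k)))"
      using G xc f(1) by (simp add: iota.f_gact iota.B.GA.A.m_assoc iota.A.GR.G.m_assoc)
    also have "\<dots> = \<iota> (gact A g (?f (h, k))) \<otimes>\<^bsub>B\<^esub> x g \<otimes>\<^bsub>B\<^esub> gact B g (x (h \<otimes>\<^bsub>G\<^esub> k))"
      using G xc f(1) by (simp add: fx[symmetric] iota.f_gact iota.B.GA.A.m_assoc)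
    also have "\<dots> = x g \<otimes>\<^bsub>B\<^esub> \<iota> (gact A g (?f (h, k))) \<otimes>\<^bsub>B\<^esub> gact B g (x (h \<otimes>\<^bsub>G\<^esub> k))"
      using G xc f(1) iota_central[of "gact A g (?f (h, k))" "x g"] by simp
    also have "\<dots> = x g \<otimes>\<^bsub>B\<^esub> gact B g (\<iota> (?f (h, k)) \<otimes>\<^bsub>B\<^esub> x (h \<otimes>\<^bsub>G\<^esub> k))"
      using G xc f(1) by (simp add: iota.f_gact iota.B.GA.act_distrib iota.B.GA.A.m_assoc)
    also have "\<dots> = (x g \<otimes>\<^bsub>B\<^esub> gact B g (x h)) \<otimes>\<^bsub>B\<^esub> gact B (g \<otimes>\<^bsub>G\<^esub> h) (x k)"
      using G xc by (simp add: fx[symmetric] iota.B.GA.act_simps iota.B.GA.A.m_assoc)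
    also have "\<dots> = \<iota> (?f (g, h)) \<otimes>\<^bsub>B\<^esub> (x (g \<otimes>\<^bsub>G\<^esub> h) \<otimes>\<^bsub>B\<^esub> gact B (g \<otimes>\<^bsub>G\<^esub> h) (x k))"
      unfolding fx[OF G(1,2)] using G xc f(1) by (simp add: iota.B.GA.A.m_assoc)
    also have "\<dots> = \<iota> (?f (g, h)) \<otimes>\<^bsub>B\<^esub> \<iota> (?f (g \<otimes>\<^bsub>G\<^esub> h, k)) \<otimes>\<^bsub>B\<^esub> ?w"
      using G xc f(1) by (simp add: fx iota.B.GA.A.m_assoc)
    also have "\<dots> = \<iota> ?r \<otimes>\<^bsub>B\<^esub> ?w"
      using G f(1) iota_central[of "?f (g, h)" "\<iota> (?f (g \<otimes>\<^bsub>G\<^esub> h, k))"] by simp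
    finally show "\<iota> ?l = \<iota> ?r"
      using G xc f(1) by simp
  qed (use G f(1) in auto)
  with cont show "?f \<in> cocycles2 G A"
    by (simp add: cocycles2_def)
qed

text \<open>A change of lift and a change of representative in C are treated together:
  \<open>b\<close> lifts the twisting element, and \<open>b = \<one>\<close> compares two lifts of
  one crossed homomorphism.\<close>

lemma lift_cocycle_rel:
  assumes x: "continuous_map (topo G) (topo B) x" "\<pi> \<circ> x \<in> crossed_homs G C"
    and y: "continuous_map (topo G) (topo B) y" "\<pi> \<circ> y \<in> crossed_homs G C"
    and b: "b \<in> carrier B"
    and xy: "\<And>g. g \<in> carrier G \<Longrightarrow> \<pi> (y g) = twist C (\<pi> b) (\<pi> \<circ> x) g"
  shows "(lift_cocycle G A B \<iota> x, lift_cocycle G A B \<iota> y) \<in> H2_rel G A"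
proof -
  \<comment> \<open>The discrepancy between \<open>y\<close> and the twist of \<open>x\<close>. Both
    lie over the same cochain of C, so it takes values in A.\<close>
  define \<kappa> where "\<kappa> g = iota_inv (inv\<^bsub>B\<^esub> (twist B b x g) \<otimes>\<^bsub>B\<^esub> y g)" for g
  let ?f = "lift_cocycle G A B \<iota> x" and ?f' = "lift_cocycle G A B \<iota> y"
  have xc: "x g \<in> carrier B" "y g \<in> carrier B" if "g \<in> carrier G" for g
    using that cochain_closed[OF x(1)] cochain_closed[OF y(1)] by blast+
  have tc: "twist B b x g \<in> carrier B" if "g \<in> carrier G" for g
    using that xc b by (simp add: twist_def)
  have ker: "\<pi> (inv\<^bsub>B\<^esub> (twist B b x g) \<otimes>\<^bsub>B\<^esub> y g) = \<one>\<^bsub>C\<^esub>" if "g \<in> carrier G" for g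
    using that xc tc b xy by (intro pi_eq_cancel) (simp_all add: twist_def pi.f_gact)
  have k: "\<kappa> g \<in> carrier A" "y g = twist B b x g \<otimes>\<^bsub>B\<^esub> \<iota> (\<kappa> g)" if "g \<in> carrier G" for g
    using that iota_iota_inv[OF _ ker[OF that]] xc tc
    by (simp_all add: \<kappa>_def iota.B.GA.A.inv_cancel_left)
  have kcont: "continuous_map (topo G) (topo A) \<kappa>"
    unfolding \<kappa>_def twist_def using x(1) y(1) b ker
    by (intro continuous_map_iota_inv iota.B.GA.A.continuous_map_mult iota.B.GA.continuous_map_act
        iota.B.GA.A.continuous_map_inv iota.B.GA.A.continuous_map_const_carrier
        continuous_map_id[unfolded id_def])
      (auto simp: twist_def iota.A.GR.G.topspace_topo)
  note fx = lift_cocycle_cocycle[OF x] and fy = lift_cocycle_cocycle[OF y]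
  have "?f' (g, h) = ?f (g, h) \<otimes>\<^bsub>A\<^esub> coboundary2 G A \<kappa> (g, h)" (is "_ = ?r")
    if G: "g \<in> carrier G" "h \<in> carrier G" for g h
  proof (rule iota_eqD)
    have fc: "?f (g, h) \<in> carrier A" "?f' (g, h) \<in> carrier A"
      using G fx(1) fy(1) iota.A.coh.cocycles2_closed by blast+
    show "?f' (g, h) \<in> carrier A" "?r \<in> carrier A"
      using G k(1) fc by (simp_all add: coboundary2_def)
    \<comment> \<open>Equality is tested after multiplying by \<open>y (g \<otimes> h)\<close>: each
      value of \<open>y\<close> is expanded as a twisted value of \<open>x\<close> times a central
      element.\<close>
    have "\<iota> (?f' (g, h)) \<otimes>\<^bsub>B\<^esub> y (g \<otimes>\<^bsub>G\<^esub> h) = y g \<otimes>\<^bsub>B\<^esub> gact B g (y h)"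
      using G fy(2) by simp
    also have "\<dots> = (inv\<^bsub>B\<^esub> b \<otimes>\<^bsub>B\<^esub> x g \<otimes>\<^bsub>B\<^esub> gact B g b \<otimes>\<^bsub>B\<^esub> \<iota> (\<kappa> g)) \<otimes>\<^bsub>B\<^esub>
        (inv\<^bsub>B\<^esub> (gact B g b) \<otimes>\<^bsub>B\<^esub> gact B g (x h) \<otimes>\<^bsub>B\<^esub> gact B (g \<otimes>\<^bsub>G\<^esub> h) b
          \<otimes>\<^bsub>B\<^esub> \<iota> (gact A g (\<kappa> h)))"
      using G k xc b by (simp add: twist_def iota.B.GA.act_simps iota.f_gact)
    also have "\<dots> = (\<iota> (?f (g, h)) \<otimes>\<^bsub>B\<^esub>
          (\<iota> (gact A g (\<kappa> h)) \<otimes>\<^bsub>B\<^esub> inv\<^bsub>B\<^esub> (\<iota> (\<kappa> (g \<otimes>\<^bsub>G\<^esub> h))) \<otimes>\<^bsub>B\<^esub> \<iota> (\<kappa> g))) \<otimes>\<^bsub>B\<^esub>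
        (inv\<^bsub>B\<^esub> b \<otimes>\<^bsub>B\<^esub> x (g \<otimes>\<^bsub>G\<^esub> h) \<otimes>\<^bsub>B\<^esub> gact B (g \<otimes>\<^bsub>G\<^esub> h) b \<otimes>\<^bsub>B\<^esub> \<iota> (\<kappa> (g \<otimes>\<^bsub>G\<^esub> h)))"
      using G k(1) xc b fc by (intro iota.B.GA.A.central_twist fx(2)) (auto intro!: iota_central)
    also have "\<dots> = \<iota> ?r \<otimes>\<^bsub>B\<^esub> y (g \<otimes>\<^bsub>G\<^esub> h)"
      using G k fc by (simp add: coboundary2_def twist_def)
    finally show "\<iota> (?f' (g, h)) = \<iota> ?r"
      using G xc fc \<open>?r \<in> carrier A\<close> by simp
  qed
  then show ?thesis
    unfolding H2_rel_def using kcont fx(1) fy(1) by auto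
qed

lemma section_lift:
  assumes "continuous_section B C \<pi> s" "\<alpha> \<in> crossed_homs G C"
  shows "continuous_map (topo G) (topo B) (s \<circ> \<alpha>)"
    and "\<And>g. g \<in> carrier G \<Longrightarrow> \<pi> (s (\<alpha> g)) = \<alpha> g"
    and "\<pi> \<circ> (s \<circ> \<alpha>) \<in> crossed_homs G C"
    and "delta1_cochain G A B \<iota> s \<alpha> = lift_cocycle G A B \<iota> (s \<circ> \<alpha>)"
proof -
  show "continuous_map (topo G) (topo B) (s \<circ> \<alpha>)"
    using assms by (auto simp: continuous_section_def crossed_homs_def intro: continuous_map_compose)
  show *: "\<pi> (s (\<alpha> g)) = \<alpha> g" if "g \<in> carrier G" for g
    using that assms pi.B.coh.crossed_homs_closed by (simp add: continuous_section_def)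
  then show "\<pi> \<circ> (s \<circ> \<alpha>) \<in> crossed_homs G C"
    using pi.B.coh.crossed_homs_cong[OF assms(2)] by simp
  show "delta1_cochain G A B \<iota> s \<alpha> = lift_cocycle G A B \<iota> (s \<circ> \<alpha>)"
    by (simp add: delta1_cochain_def lift_cocycle_def)
qed

text \<open>Lifting the twisting element \<open>c\<close> to B reduces this to
  \<open>lift_cocycle_rel\<close>, with \<open>s \<circ> \<alpha>\<close> and
  \<open>s' \<circ> \<beta>\<close> as the two lifts. Section and representative vary at once, as
  they do in the double union \<open>delta1\<close>.\<close>

lemma delta1_cochain_rel:
  assumes "continuous_section B C \<pi> s" "continuous_section B C \<pi> s'"
    and "((\<alpha>, r), (\<beta>, t)) \<in> Der_rel G R C"
  shows "(delta1_cochain G A B \<iota> s \<alpha>, delta1_cochain G A B \<iota> s' \<beta>) \<in> H2_rel G A"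
proof -
  obtain c where ab: "\<alpha> \<in> crossed_homs G C" "\<beta> \<in> crossed_homs G C"
    and c: "c \<in> carrier C" "\<forall>g \<in> carrier G. \<beta> g = twist C c \<alpha> g"
    using assms(3) unfolding pi.B.Der_rel_iff pi.B.Der_c_iff by blast
  obtain b where b: "b \<in> carrier B" "\<pi> b = c"
    using pi_lift[OF c(1)] by blast
  show ?thesis
    unfolding section_lift(4)[OF assms(1) ab(1)] section_lift(4)[OF assms(2) ab(2)]
    by (rule lift_cocycle_rel[OF section_lift(1,3)[OF assms(1) ab(1)]
          section_lift(1,3)[OF assms(2) ab(2)] b(1)])
      (use b c section_lift(2)[OF assms(1) ab(1)] section_lift(2)[OF assms(2) ab(2)]
        in \<open>simp add: twist_def\<close>)
qed

lemma delta1_eq: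
  assumes "(\<alpha>, r) \<in> Der_c G R C" "continuous_section B C \<pi> s"
  shows "delta1 G A B C \<iota> \<pi> (Der_rel G R C `` {(\<alpha>, r)}) = H2_rel G A `` {delta1_cochain G A B \<iota> s \<alpha>}"
proof -
  have *: "(\<Union>s' \<in> {s. continuous_section B C \<pi> s}. H2_rel G A `` {delta1_cochain G A B \<iota> s' \<beta>})
      = H2_rel G A `` {delta1_cochain G A B \<iota> s \<alpha>}"
    if "((\<alpha>, r), (\<beta>, t)) \<in> Der_rel G R C" for \<alpha> r \<beta> t
  proof -
    have "H2_rel G A `` {delta1_cochain G A B \<iota> s' \<beta>} = H2_rel G A `` {delta1_cochain G A B \<iota> s \<alpha>}"
      if "continuous_section B C \<pi> s'" for s'
      using equiv_class_eq[OF equivs(4) delta1_cochain_rel[OF assms(2) that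
            \<open>((\<alpha>, r), (\<beta>, t)) \<in> Der_rel G R C\<close>]] by simp
    then show ?thesis using assms(2) by auto
  qed
  \<comment> \<open>Reflexivity makes the index set nonempty, so the union of equal classes is that
    class and not the empty set.\<close>
  have "((\<alpha>, r), (\<alpha>, r)) \<in> Der_rel G R C"
    using equivs(3) assms(1) by (auto simp: equiv_def refl_on_def)
  then show ?thesis
    unfolding delta1_def using *[of \<alpha> r] by (auto split: prod.splits)
qed

lemma iota_inv_one [simp]: "iota_inv \<one>\<^bsub>B\<^esub> = \<one>\<^bsub>A\<^esub>"
  using iota_inv_iota[of "\<one>\<^bsub>A\<^esub>"] by simp

text \<open>The crossed homomorphism \<open>\<beta>\<close> is itself a lift of
  \<open>\<pi> \<circ> \<beta>\<close>, with trivial defect; the lift through \<open>s\<close> has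
  an equivalent defect.\<close>

lemma delta1_pi:
  assumes "(\<beta>, r) \<in> Der_c G R B"
  shows "delta1 G A B C \<iota> \<pi> (Der_rel G R C `` {(\<pi> \<circ> \<beta>, r)}) = H2_rel G A `` {\<lambda>_. \<one>\<^bsub>A\<^esub>}"
proof -
  obtain s where s: "continuous_section B C \<pi> s"
    using has_section by blast
  have \<beta>: "\<beta> \<in> crossed_homs G B" and \<beta>cont: "continuous_map (topo G) (topo B) \<beta>"
    using assms by (auto simp: iota.B.Der_c_iff crossed_homs_def)
  note \<beta>cl = iota.B.coh.crossed_homs_closed[OF \<beta>]
  note \<pi>\<beta> = pi.crossed_hom_image[OF \<beta>]
  note sl = section_lift[OF s \<pi>\<beta>]
  have "(lift_cocycle G A B \<iota> \<beta>, lift_cocycle G A B \<iota> (s \<circ> (\<pi> \<circ> \<beta>))) \<in> H2_rel G A"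
    using \<beta>cl sl(2)
    by (intro lift_cocycle_rel[OF \<beta>cont \<pi>\<beta> sl(1,3), of "\<one>\<^bsub>B\<^esub>"]) (simp_all add: twist_def)
  \<comment> \<open>The defect is trivial on \<open>carrier G\<close> only, so this is a relation,
    witnessed by the constant cochain.\<close>
  moreover have "(\<lambda>_. \<one>\<^bsub>A\<^esub>, lift_cocycle G A B \<iota> \<beta>) \<in> H2_rel G A"
  proof -
    have "lift_cocycle G A B \<iota> \<beta> (g, h) = \<one>\<^bsub>A\<^esub>" if "g \<in> carrier G" "h \<in> carrier G" for g h
    proof -
      have "\<beta> g \<otimes>\<^bsub>B\<^esub> gact B g (\<beta> h) = \<beta> (g \<otimes>\<^bsub>G\<^esub> h)"
        using \<beta> that by (simp add: crossed_homs_def)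
      then show ?thesis
        using \<beta>cl[of "g \<otimes>\<^bsub>G\<^esub> h"] that by (simp add: lift_cocycle_def)
    qed
    then show ?thesis
      using lift_cocycle_cocycle(1)[OF \<beta>cont \<pi>\<beta>] iota.A.coh.one_cocycle2
      by (auto simp: H2_rel_def coboundary2_def
          intro!: exI[of _ "\<lambda>_. \<one>\<^bsub>A\<^esub>"] iota.A.GA.A.continuous_map_const_carrier
          simp del: continuous_map_const)
  qed
  ultimately have "(\<lambda>_. \<one>\<^bsub>A\<^esub>, delta1_cochain G A B \<iota> s (\<pi> \<circ> \<beta>)) \<in> H2_rel G A"
    using equivs(4) unfolding sl(4) by (meson equivE transD)
  then show ?thesis
    using delta1_eq[OF pi.Der_c_image[OF assms] s] equiv_class_eq[OF equivs(4)] by metis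
qed

section \<open>Base points and targets of the six maps\<close>

lemma pi_one: "\<pi> \<circ> (\<lambda>_. \<one>\<^bsub>B\<^esub>) = (\<lambda>_. \<one>\<^bsub>C\<^esub>)"
  by (simp add: o_def)

lemma iota_one: "\<iota> \<circ> (\<lambda>_. \<one>\<^bsub>A\<^esub>) = (\<lambda>_. \<one>\<^bsub>B\<^esub>)"
  by (simp add: o_def)

lemma pointed_map_iota0: "pointed_map (pH0 G A) \<iota> (pH0 G B)"
  by (auto simp: pointed_map_def pH0_def iota.A.coh.H0_one iota.B.coh.H0_one intro: iota.H0_image)

lemma pointed_map_pi0: "pointed_map (pH0 G B) \<pi> (pH0 G C)"
  by (auto simp: pointed_map_def pH0_def iota.B.coh.H0_one pi.B.coh.H0_one intro: pi.H0_image)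

text \<open>The invariant element \<open>b\<close> may itself be taken as the lift, and its
  connecting cochain is trivial.\<close>

lemma delta0_pi:
  assumes "b \<in> H0 G B"
  shows "delta0 G A B \<iota> \<pi> (\<pi> b) = H1_rel G A `` {\<lambda>_. \<one>\<^bsub>A\<^esub>}"
proof -
  have b: "b \<in> carrier B" "\<pi> b \<in> H0 G C"
    using assms pi.H0_image by (auto simp: H0_def)
  have "(\<lambda>_. \<one>\<^bsub>A\<^esub>, \<lambda>g. iota_inv (inv\<^bsub>B\<^esub> b \<otimes>\<^bsub>B\<^esub> gact B g b)) \<in> H1_rel G A"
    using assms b(1)
    by (intro iota.A.coh.H1_rel_cong iota.A.coh.one_crossed_hom) (simp add: H0_def)
  then show ?thesis
    unfolding delta0_eq[OF b] by (rule equiv_class_eq[OF equivs(1), symmetric])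
qed

lemma pointed_map_delta0: "pointed_map (pH0 G C) (delta0 G A B \<iota> \<pi>) (pH1 G A)"
proof -
  have "delta0 G A B \<iota> \<pi> c \<in> H1 G A" if "c \<in> H0 G C" for c
  proof -
    obtain b where "b \<in> carrier B" "\<pi> b = c"
      using pi_lift[OF pi.B.coh.H0_closed[OF \<open>c \<in> H0 G C\<close>]] by blast
    then show ?thesis
      using that delta0_eq[of b] connecting_crossed_hom(1)[of b]
      by (auto simp: H1_def intro: quotientI)
  qed
  then show ?thesis
    using delta0_pi[OF iota.B.coh.H0_one]
    by (auto simp: pointed_map_def pH0_def pH1_def pi.B.coh.H0_one H1_def
        intro: quotientI iota.A.coh.one_crossed_hom)
qed

lemma pointed_map_iota1: "pointed_map (pH1 G A) (iota1 G R B \<iota>) (pH1_pair G R B)"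
  using iota1_eq[OF iota.A.coh.one_crossed_hom]
  by (auto simp: pointed_map_def pH1_def pH1_pair_def H1_def H1_pair_def iota1_eq iota_one
      elim!: quotientE
      intro!: quotientI iota.A.coh.one_crossed_hom iota.B.one_Der_c iota.Der_c_image A_Der_c)

lemma pointed_map_pi1: "pointed_map (pH1_pair G R B) (pi1 G R C \<pi>) (pH1_pair G R C)"
  using pi1_eq[OF iota.B.one_Der_c]
  by (auto simp: pointed_map_def pH1_pair_def H1_pair_def pi1_eq pi_one
      elim!: quotientE
      intro!: quotientI iota.B.one_Der_c pi.B.one_Der_c pi.Der_c_image)

lemma pointed_map_delta1: "pointed_map (pH1_pair G R C) (delta1 G A B C \<iota> \<pi>) (pH2 G A)"
proof -
  obtain s where s: "continuous_section B C \<pi> s"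
    using has_section by blast
  have "delta1 G A B C \<iota> \<pi> X \<in> H2 G A" if X: "X \<in> H1_pair G R C" for X
  proof -
    obtain \<alpha> r where \<alpha>: "(\<alpha>, r) \<in> Der_c G R C" "X = Der_rel G R C `` {(\<alpha>, r)}"
      using X unfolding H1_pair_def by (metis quotientE surj_pair)
    then have "\<alpha> \<in> crossed_homs G C" by (simp add: pi.B.Der_c_iff)
    note sl = section_lift[OF s this]
    show ?thesis
      unfolding \<alpha>(2) delta1_eq[OF \<alpha>(1) s] H2_def sl(4)
      by (rule quotientI) (rule lift_cocycle_cocycle(1)[OF sl(1,3)])
  qed
  then show ?thesis
    using delta1_pi[OF iota.B.one_Der_c]
    by (auto simp: pointed_map_def pH1_pair_def pH2_def H1_pair_def H2_def pi_one
      intro!: quotientI pi.B.one_Der_c iota.A.coh.one_cocycle2)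
qed

subsection \<open>Exactness\<close>

text \<open>The one-point set of the unit type is the term \<open>0\<close> of the sequence, so
  exactness says that \<open>\<iota>\<close> has trivial kernel on invariants.\<close>

lemma exact_H0_A: "pointed_exact ({()}, ()) (\<lambda>_. \<one>\<^bsub>A\<^esub>) (pH0 G A) \<iota> (pH0 G B)"
proof -
  have "pointed_map ({()}, ()) (\<lambda>_. \<one>\<^bsub>A\<^esub>) (pH0 G A)"
    by (simp add: pointed_map_def pH0_def iota.A.coh.H0_one)
  moreover have "a = \<one>\<^bsub>A\<^esub>" if "a \<in> H0 G A" "\<iota> a = \<one>\<^bsub>B\<^esub>" for a
    using that iota_eqD[of a "\<one>\<^bsub>A\<^esub>"] by (simp add: H0_def)
  ultimately show ?thesis
    using pointed_map_iota0 by (auto simp: pointed_exact_def pH0_def iota.A.coh.H0_one)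
qed

lemma exact_H0_B: "pointed_exact (pH0 G A) \<iota> (pH0 G B) \<pi> (pH0 G C)"
proof -
  have "b \<in> \<iota> ` H0 G A" if b: "b \<in> H0 G B" "\<pi> b = \<one>\<^bsub>C\<^esub>" for b
  proof -
    obtain a where a: "a \<in> carrier A" "\<iota> a = b"
      using b iota_iota_inv[of b] by (auto simp: H0_def)
    \<comment> \<open>Invariance descends from \<open>b\<close> to its preimage because
      \<open>\<iota>\<close> is equivariant and injective.\<close>
    have "gact A g a = a" if "g \<in> carrier G" for g
      using a b that by (intro iota_eqD) (simp_all add: iota.f_gact H0_def)
    with a show ?thesis by (auto simp: H0_def)
  qed
  moreover have "\<pi> (\<iota> a) = \<one>\<^bsub>C\<^esub>" if "a \<in> H0 G A" for a
    using that by (simp add: H0_def)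
  ultimately show ?thesis
    using pointed_map_iota0 pointed_map_pi0 iota.H0_image by (auto simp: pointed_exact_def pH0_def)
qed

lemma exact_H0_C: "pointed_exact (pH0 G B) \<pi> (pH0 G C) (delta0 G A B \<iota> \<pi>) (pH1 G A)"
proof -
  have "c \<in> \<pi> ` H0 G B"
    if c: "c \<in> H0 G C" and d: "delta0 G A B \<iota> \<pi> c = H1_rel G A `` {\<lambda>_. \<one>\<^bsub>A\<^esub>}" for c
  proof -
    obtain b where b: "b \<in> carrier B" "\<pi> b = c"
      using pi_lift[OF pi.B.coh.H0_closed[OF c]] by blast
    let ?\<alpha> = "\<lambda>g. iota_inv (inv\<^bsub>B\<^esub> b \<otimes>\<^bsub>B\<^esub> gact B g b)"
    have \<alpha>: "?\<alpha> \<in> crossed_homs G A"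
      "\<And>g. g \<in> carrier G \<Longrightarrow> \<iota> (?\<alpha> g) = inv\<^bsub>B\<^esub> b \<otimes>\<^bsub>B\<^esub> gact B g b"
      using connecting_crossed_hom[of b] b c by auto
    have "(?\<alpha>, \<lambda>_. \<one>\<^bsub>A\<^esub>) \<in> H1_rel G A"
      using d delta0_eq[of b] b c eq_equiv_class[OF _ equivs(1)] iota.A.coh.one_crossed_hom by auto
    then obtain a where a: "a \<in> carrier A"
      "\<And>g. g \<in> carrier G \<Longrightarrow> \<one>\<^bsub>B\<^esub> = twist B (\<iota> a) (\<iota> \<circ> ?\<alpha>) g"
      using H1_rel_A_iff[OF \<alpha>(1) iota.A.coh.one_crossed_hom] by auto
    \<comment> \<open>The relation obtained for \<open>a\<close> says exactly that the corrected
      lift \<open>b \<otimes> \<iota> a\<close> is invariant; it still lies over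
      \<open>c\<close>.\<close>
    have "gact B g (b \<otimes>\<^bsub>B\<^esub> \<iota> a) = b \<otimes>\<^bsub>B\<^esub> \<iota> a" if g: "g \<in> carrier G" for g
    proof -
      have "inv\<^bsub>B\<^esub> (b \<otimes>\<^bsub>B\<^esub> \<iota> a) \<otimes>\<^bsub>B\<^esub> gact B g (b \<otimes>\<^bsub>B\<^esub> \<iota> a) = \<one>\<^bsub>B\<^esub>"
        using a(2)[OF g] g a(1) b(1) \<alpha>(2)[OF g]
        by (simp add: twist_def iota.B.GA.A.word_simps iota.B.GA.act_simps)
      then show ?thesis
        using g a(1) b(1) iota.B.GA.A.inv_solve_left'[of "\<one>\<^bsub>B\<^esub>" "b \<otimes>\<^bsub>B\<^esub> \<iota> a" "gact B g (b \<otimes>\<^bsub>B\<^esub> \<iota> a)"]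
        by simp
    qed
    then have "b \<otimes>\<^bsub>B\<^esub> \<iota> a \<in> H0 G B"
      using a(1) b(1) by (simp add: H0_def)
    moreover have "\<pi> (b \<otimes>\<^bsub>B\<^esub> \<iota> a) = c"
      using a(1) b by (auto simp flip: b(2))
    ultimately show ?thesis by force
  qed
  then show ?thesis
    using pointed_map_pi0 pointed_map_delta0 pi.H0_image delta0_pi
    by (auto simp: pointed_exact_def pH0_def pH1_def)
qed

lemma exact_H1_A:
  "pointed_exact (pH0 G C) (delta0 G A B \<iota> \<pi>) (pH1 G A) (iota1 G R B \<iota>) (pH1_pair G R B)"
proof -
  have "iota1 G R B \<iota> (delta0 G A B \<iota> \<pi> c) = Der_rel G R B `` {(\<lambda>_. \<one>\<^bsub>B\<^esub>, \<one>\<^bsub>R\<^esub>)}"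
    if c: "c \<in> H0 G C" for c
  proof -
    obtain b where b: "b \<in> carrier B" "\<pi> b = c"
      using pi_lift[OF pi.B.coh.H0_closed[OF c]] by blast
    let ?\<alpha> = "\<lambda>g. iota_inv (inv\<^bsub>B\<^esub> b \<otimes>\<^bsub>B\<^esub> gact B g b)"
    have \<alpha>: "?\<alpha> \<in> crossed_homs G A"
      "\<And>g. g \<in> carrier G \<Longrightarrow> \<iota> (?\<alpha> g) = inv\<^bsub>B\<^esub> b \<otimes>\<^bsub>B\<^esub> gact B g b"
      using connecting_crossed_hom[of b] b c by auto
    \<comment> \<open>This element equals \<open>smap C (\<pi> b)\<close>, and
      \<open>\<pi> b\<close> is invariant. It serves as the \<open>z\<close> of the relation:
      twisting the trivial pair by \<open>b\<close> turns the second component into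
      \<open>inv (smap B b)\<close>, and \<open>z\<close> restores \<open>\<one>\<close>.\<close>
    have "smap B b \<in> H0 G R"
      using b c by (auto simp: H0_def pi.B.smap_gact[symmetric] simp flip: pi.smap_f)
    then have "((\<lambda>_. \<one>\<^bsub>B\<^esub>, \<one>\<^bsub>R\<^esub>), (\<iota> \<circ> ?\<alpha>, \<one>\<^bsub>R\<^esub>)) \<in> Der_rel G R B"
      unfolding iota.B.Der_rel_iff
      using b(1) \<alpha>(2) iota.B.one_Der_c iota.Der_c_image[OF A_Der_c[OF \<alpha>(1)]]
      by (auto simp: twist_def intro!: bexI[of _ b] bexI[of _ "smap B b"])
    then show ?thesis
      using equiv_class_eq[OF equivs(2)] iota1_eq[OF \<alpha>(1)] delta0_eq[of b] b c by auto
  qed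
  moreover have "X \<in> delta0 G A B \<iota> \<pi> ` H0 G C"
    if X: "X \<in> H1 G A" "iota1 G R B \<iota> X = Der_rel G R B `` {(\<lambda>_. \<one>\<^bsub>B\<^esub>, \<one>\<^bsub>R\<^esub>)}" for X
  proof -
    obtain \<alpha> where \<alpha>: "\<alpha> \<in> crossed_homs G A" "X = H1_rel G A `` {\<alpha>}"
      using X(1) unfolding H1_def by (rule quotientE)
    have "((\<lambda>_. \<one>\<^bsub>B\<^esub>, \<one>\<^bsub>R\<^esub>), (\<iota> \<circ> \<alpha>, \<one>\<^bsub>R\<^esub>)) \<in> Der_rel G R B"
      using X(2) \<alpha> iota1_eq iota.Der_c_image[OF A_Der_c[OF \<alpha>(1)]] eq_equiv_class[OF _ equivs(2)]
      by metis
    then obtain b where b: "b \<in> carrier B"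
      and e: "\<And>g. g \<in> carrier G \<Longrightarrow> \<iota> (\<alpha> g) = inv\<^bsub>B\<^esub> b \<otimes>\<^bsub>B\<^esub> gact B g b"
      unfolding iota.B.Der_rel_iff by (auto simp: twist_def)
    \<comment> \<open>By \<open>e\<close> the class comes from the very cochain that
      \<open>delta0\<close> attaches to the lift \<open>b\<close>. Its values lie in A, so applying
      \<open>\<pi>\<close> makes \<open>\<pi> b\<close> invariant.\<close>
    have "gact C g (\<pi> b) = \<pi> b" if g: "g \<in> carrier G" for g
    proof -
      have "\<pi> (inv\<^bsub>B\<^esub> b \<otimes>\<^bsub>B\<^esub> gact B g b) = \<one>\<^bsub>C\<^esub>"
        using iota.A.coh.crossed_homs_closed[OF \<alpha>(1) g] by (simp flip: e[OF g])
      then show ?thesis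
        using b g pi.B.GA.A.inv_solve_left'[of "\<one>\<^bsub>C\<^esub>" "\<pi> b" "gact C g (\<pi> b)"]
        by (simp add: pi.f_gact)
    qed
    then have \<pi>b: "\<pi> b \<in> H0 G C"
      using b by (simp add: H0_def)
    have "(\<alpha>, \<lambda>g. iota_inv (inv\<^bsub>B\<^esub> b \<otimes>\<^bsub>B\<^esub> gact B g b)) \<in> H1_rel G A"
      using iota.A.coh.crossed_homs_closed[OF \<alpha>(1)]
      by (intro iota.A.coh.H1_rel_cong \<alpha>(1)) (simp flip: e)
    then have "X = delta0 G A B \<iota> \<pi> (\<pi> b)"
      unfolding \<alpha>(2) delta0_eq[OF b \<pi>b] by (rule equiv_class_eq[OF equivs(1)])
    with \<pi>b show ?thesis by blast
  qed
  ultimately show ?thesis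
    using pointed_map_delta0 pointed_map_iota1
    by (auto simp: pointed_exact_def pointed_map_def pH0_def pH1_def pH1_pair_def)
qed

lemma exact_H1_B:
  "pointed_exact (pH1 G A) (iota1 G R B \<iota>) (pH1_pair G R B) (pi1 G R C \<pi>) (pH1_pair G R C)"
proof -
  have "pi1 G R C \<pi> (iota1 G R B \<iota> X) = Der_rel G R C `` {(\<lambda>_. \<one>\<^bsub>C\<^esub>, \<one>\<^bsub>R\<^esub>)}"
    if X: "X \<in> H1 G A" for X
  proof -
    obtain \<alpha> where \<alpha>: "\<alpha> \<in> crossed_homs G A" "X = H1_rel G A `` {\<alpha>}"
      using X unfolding H1_def by (rule quotientE)
    \<comment> \<open>The composite agrees with the trivial cochain on \<open>carrier G\<close>
      only, hence a relation between representatives.\<close>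
    have "((\<lambda>_. \<one>\<^bsub>C\<^esub>, \<one>\<^bsub>R\<^esub>), (\<pi> \<circ> (\<iota> \<circ> \<alpha>), \<one>\<^bsub>R\<^esub>)) \<in> Der_rel G R C"
      using iota.A.coh.crossed_homs_closed[OF \<alpha>(1)]
      by (intro pi.B.Der_rel_cong pi.B.one_Der_c) simp
    then show ?thesis
      unfolding \<alpha>(2) iota1_eq[OF \<alpha>(1)] pi1_eq[OF iota.Der_c_image[OF A_Der_c[OF \<alpha>(1)]]]
      by (rule equiv_class_eq[OF equivs(3), symmetric])
  qed
  moreover have "Y \<in> iota1 G R B \<iota> ` H1 G A"
    if Y: "Y \<in> H1_pair G R B" "pi1 G R C \<pi> Y = Der_rel G R C `` {(\<lambda>_. \<one>\<^bsub>C\<^esub>, \<one>\<^bsub>R\<^esub>)}" for Y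
  proof -
    obtain \<beta> r where \<beta>: "(\<beta>, r) \<in> Der_c G R B" "Y = Der_rel G R B `` {(\<beta>, r)}"
      using Y(1) unfolding H1_pair_def by (metis quotientE surj_pair)
    then have \<beta>cl: "\<beta> \<in> crossed_homs G B" by (simp add: iota.B.Der_c_iff)
    have "((\<pi> \<circ> \<beta>, r), (\<lambda>_. \<one>\<^bsub>C\<^esub>, \<one>\<^bsub>R\<^esub>)) \<in> Der_rel G R C"
      using Y(2) unfolding \<beta>(2) pi1_eq[OF \<beta>(1)]
      by (rule eq_equiv_class[OF _ equivs(3) pi.B.one_Der_c])
    then obtain c z where c: "c \<in> carrier C" "\<forall>g \<in> carrier G. \<one>\<^bsub>C\<^esub> = twist C c (\<pi> \<circ> \<beta>) g"
      and z: "z \<in> H0 G R" "\<one>\<^bsub>R\<^esub> = inv\<^bsub>R\<^esub> (smap C c) \<otimes>\<^bsub>R\<^esub> r \<otimes>\<^bsub>R\<^esub> z"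
      unfolding pi.B.Der_rel_iff by blast
    obtain b where b: "b \<in> carrier B" "\<pi> b = c"
      using pi_lift[OF c(1)] by blast
    let ?\<beta> = "twist B b \<beta>"
    \<comment> \<open>Since \<open>b\<close> lifts \<open>c\<close>, the structure maps agree on
      them, so the \<open>z\<close> found over C also normalises the second component over B.
      Twisting by \<open>b\<close> thus makes the pair trivial over C, and its cochain factors
      through \<open>\<iota>\<close>.\<close>
    have one: "inv\<^bsub>R\<^esub> (smap B b) \<otimes>\<^bsub>R\<^esub> r \<otimes>\<^bsub>R\<^esub> z = \<one>\<^bsub>R\<^esub>"
      unfolding pi.smap_f[OF b(1), symmetric] b(2) by (rule z(2)[symmetric])
    have rel: "((\<beta>, r), (?\<beta>, \<one>\<^bsub>R\<^esub>)) \<in> Der_rel G R B" and der: "(?\<beta>, \<one>\<^bsub>R\<^esub>) \<in> Der_c G R B"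
      using iota.B.Der_rel_twist[OF \<beta>(1) b(1) z(1)] iota.B.twist_Der_c[OF \<beta>(1) b(1) z(1)]
      unfolding one by auto
    have "\<pi> (?\<beta> g) = \<one>\<^bsub>C\<^esub>" if "g \<in> carrier G" for g
      using bspec[OF c(2) that] by (simp add: pi.twist_image[OF b(1) \<beta>cl that] b(2))
    note \<alpha> = crossed_hom_iota_inv[OF iota.B.coh.twist_crossed_hom[OF b(1) \<beta>cl] this]
    let ?\<alpha> = "\<lambda>g. iota_inv (?\<beta> g)"
    have rel': "((?\<beta>, \<one>\<^bsub>R\<^esub>), (\<iota> \<circ> ?\<alpha>, \<one>\<^bsub>R\<^esub>)) \<in> Der_rel G R B"
      using \<alpha>(2) by (intro iota.B.Der_rel_cong der) simp
    have "Y = iota1 G R B \<iota> (H1_rel G A `` {?\<alpha>})"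
      unfolding \<beta>(2) iota1_eq[OF \<alpha>(1)]
      using equiv_class_eq[OF equivs(2) rel] equiv_class_eq[OF equivs(2) rel']
      by (simp add: iota1_eq[OF \<alpha>(1)])
    then show ?thesis
      using \<alpha>(1) by (auto simp: H1_def intro: quotientI)
  qed
  ultimately show ?thesis
    using pointed_map_iota1 pointed_map_pi1
    by (auto simp: pointed_exact_def pointed_map_def pH1_def pH1_pair_def)
qed

text \<open>Dividing \<open>x\<close> by the central cochain \<open>\<iota> \<circ> \<kappa>\<close>
  divides its defect by the coboundary of \<open>\<kappa>\<close>, which leaves no defect. The image
  in C is unchanged because \<open>\<pi>\<close> kills \<open>\<iota>\<close>.\<close>

lemma crossed_hom_lift:
  assumes x: "continuous_map (topo G) (topo B) x" "\<pi> \<circ> x \<in> crossed_homs G C"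
    and rel: "(\<lambda>_. \<one>\<^bsub>A\<^esub>, lift_cocycle G A B \<iota> x) \<in> H2_rel G A"
  obtains \<beta> where "\<beta> \<in> crossed_homs G B" "\<And>g. g \<in> carrier G \<Longrightarrow> \<pi> (\<beta> g) = \<pi> (x g)"
proof -
  let ?f = "lift_cocycle G A B \<iota> x"
  obtain \<kappa> where \<kappa>: "continuous_map (topo G) (topo A) \<kappa>"
    and f: "\<And>g h. \<lbrakk>g \<in> carrier G; h \<in> carrier G\<rbrakk> \<Longrightarrow>
      ?f (g, h) = \<one>\<^bsub>A\<^esub> \<otimes>\<^bsub>A\<^esub> coboundary2 G A \<kappa> (g, h)"
    using rel unfolding H2_rel_def by auto
  note xc = cochain_closed[OF x(1)]
  have kc: "\<kappa> g \<in> carrier A" if "g \<in> carrier G" for g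
    using that iota.A.GA.A.continuous_map_in_carrier[OF \<kappa>] by (simp add: iota.A.GR.G.topspace_topo)
  define \<beta> where "\<beta> g = inv\<^bsub>B\<^esub> (\<iota> (\<kappa> g)) \<otimes>\<^bsub>B\<^esub> x g" for g
  have \<beta>k: "\<beta> g = \<iota> (inv\<^bsub>A\<^esub> (\<kappa> g)) \<otimes>\<^bsub>B\<^esub> x g" if "g \<in> carrier G" for g
    using kc[OF that] by (simp add: \<beta>_def)
  have "\<beta> (g \<otimes>\<^bsub>G\<^esub> h) = \<beta> g \<otimes>\<^bsub>B\<^esub> gact B g (\<beta> h)" if G: "g \<in> carrier G" "h \<in> carrier G" for g h
  proof -
    \<comment> \<open>The coboundary is the product of the inverse of \<open>?l\<close>, then
      \<open>?m\<close>, then the inverse of \<open>?k\<close>. After central factors are moved,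
      \<open>?k\<close> and \<open>?l\<close> cancel against it and \<open>?m\<close> remains, as in
      \<open>\<beta> (g \<otimes> h)\<close>.\<close>
    let ?k = "inv\<^bsub>B\<^esub> (\<iota> (\<kappa> g))" and ?l = "inv\<^bsub>B\<^esub> (\<iota> (gact A g (\<kappa> h)))"
    let ?m = "inv\<^bsub>B\<^esub> (\<iota> (\<kappa> (g \<otimes>\<^bsub>G\<^esub> h)))"
    have l: "?l = \<iota> (inv\<^bsub>A\<^esub> (gact A g (\<kappa> h)))"
      using G kc by simp
    have "\<beta> g \<otimes>\<^bsub>B\<^esub> gact B g (\<beta> h) = ?k \<otimes>\<^bsub>B\<^esub> (x g \<otimes>\<^bsub>B\<^esub> ?l) \<otimes>\<^bsub>B\<^esub> gact B g (x h)"
      using G kc xc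
      by (simp add: \<beta>_def iota.B.GA.act_simps iota.f_gact iota.B.GA.A.m_assoc)
    also have "\<dots> = ?k \<otimes>\<^bsub>B\<^esub> (?l \<otimes>\<^bsub>B\<^esub> x g) \<otimes>\<^bsub>B\<^esub> gact B g (x h)"
      unfolding l using G kc xc by (subst iota_central) simp_all
    also have "\<dots> = ?k \<otimes>\<^bsub>B\<^esub> ?l \<otimes>\<^bsub>B\<^esub> (x g \<otimes>\<^bsub>B\<^esub> gact B g (x h))"
      using G kc xc by (simp add: iota.B.GA.A.m_assoc)
    also have "\<dots> = ?k \<otimes>\<^bsub>B\<^esub> ?l \<otimes>\<^bsub>B\<^esub> (\<iota> (gact A g (\<kappa> h)) \<otimes>\<^bsub>B\<^esub> ?m \<otimes>\<^bsub>B\<^esub> \<iota> (\<kappa> g) \<otimes>\<^bsub>B\<^esub> x (g \<otimes>\<^bsub>G\<^esub> h))"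
      using G kc by (simp add: lift_cocycle_cocycle(2)[OF x] f coboundary2_def)
    also have "\<dots> = ?k \<otimes>\<^bsub>B\<^esub> (?m \<otimes>\<^bsub>B\<^esub> \<iota> (\<kappa> g)) \<otimes>\<^bsub>B\<^esub> x (g \<otimes>\<^bsub>G\<^esub> h)"
      using G kc xc by (simp add: iota.B.GA.A.word_simps)
    also have "?m \<otimes>\<^bsub>B\<^esub> \<iota> (\<kappa> g) = \<iota> (\<kappa> g) \<otimes>\<^bsub>B\<^esub> ?m"
      using G kc by (intro iota_central[symmetric]) simp_all
    also have "?k \<otimes>\<^bsub>B\<^esub> (\<iota> (\<kappa> g) \<otimes>\<^bsub>B\<^esub> ?m) \<otimes>\<^bsub>B\<^esub> x (g \<otimes>\<^bsub>G\<^esub> h) = \<beta> (g \<otimes>\<^bsub>G\<^esub> h)"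
      using G kc xc by (simp add: \<beta>_def iota.B.GA.A.inv_cancel_left)
    finally show ?thesis by simp
  qed
  moreover have "continuous_map (topo G) (topo B) \<beta>"
    unfolding \<beta>_def using x(1) continuous_map_compose[OF \<kappa> iota.continuous_f]
    by (intro iota.B.GA.A.continuous_map_mult iota.B.GA.A.continuous_map_inv) (simp_all add: o_def)
  ultimately have "\<beta> \<in> crossed_homs G B"
    by (simp add: crossed_homs_def)
  moreover have "\<pi> (\<beta> g) = \<pi> (x g)" if "g \<in> carrier G" for g
    using that kc xc by (simp add: \<beta>k)
  ultimately show ?thesis by (rule that)
qed

lemma exact_H1_C:
  "pointed_exact (pH1_pair G R B) (pi1 G R C \<pi>) (pH1_pair G R C) (delta1 G A B C \<iota> \<pi>) (pH2 G A)"
proof -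
  obtain s where s: "continuous_section B C \<pi> s"
    using has_section by blast
  have "delta1 G A B C \<iota> \<pi> (pi1 G R C \<pi> X) = H2_rel G A `` {\<lambda>_. \<one>\<^bsub>A\<^esub>}"
    if X: "X \<in> H1_pair G R B" for X
  proof -
    obtain \<beta> r where "(\<beta>, r) \<in> Der_c G R B" "X = Der_rel G R B `` {(\<beta>, r)}"
      using X unfolding H1_pair_def by (metis quotientE surj_pair)
    then show ?thesis by (simp add: pi1_eq delta1_pi)
  qed
  moreover have "Y \<in> pi1 G R C \<pi> ` H1_pair G R B"
    if Y: "Y \<in> H1_pair G R C" "delta1 G A B C \<iota> \<pi> Y = H2_rel G A `` {\<lambda>_. \<one>\<^bsub>A\<^esub>}" for Y
  proof -
    obtain \<alpha> r where \<alpha>: "(\<alpha>, r) \<in> Der_c G R C" "Y = Der_rel G R C `` {(\<alpha>, r)}"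
      using Y(1) unfolding H1_pair_def by (metis quotientE surj_pair)
    then have "\<alpha> \<in> crossed_homs G C" by (simp add: pi.B.Der_c_iff)
    note sl = section_lift[OF s this]
    have "(\<lambda>_. \<one>\<^bsub>A\<^esub>, lift_cocycle G A B \<iota> (s \<circ> \<alpha>)) \<in> H2_rel G A"
      using Y(2) lift_cocycle_cocycle(1)[OF sl(1,3)]
      unfolding \<alpha>(2) delta1_eq[OF \<alpha>(1) s] sl(4)
      by (intro eq_equiv_class[OF _ equivs(4)]) simp_all
    \<comment> \<open>The lift \<open>s \<circ> \<alpha>\<close> is corrected by the cochain
      trivialising its defect; the result still lies over \<open>\<alpha>\<close> on
      \<open>carrier G\<close>.\<close>
    then obtain \<beta> where \<beta>: "\<beta> \<in> crossed_homs G B" "\<And>g. g \<in> carrier G \<Longrightarrow> \<pi> (\<beta> g) = \<alpha> g"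
      using crossed_hom_lift[OF sl(1,3)] sl(2) by (metis comp_apply)
    have "smap B (\<beta> g) = smap C (\<alpha> g)" if "g \<in> carrier G" for g
      using pi.smap_f[OF iota.B.coh.crossed_homs_closed[OF \<beta>(1) that]] \<beta>(2)[OF that] by simp
    then have der: "(\<beta>, r) \<in> Der_c G R B"
      using \<alpha>(1) \<beta>(1) by (simp add: iota.B.Der_c_iff pi.B.Der_c_iff)
    have "((\<alpha>, r), (\<pi> \<circ> \<beta>, r)) \<in> Der_rel G R C"
      using \<beta>(2) by (intro pi.B.Der_rel_cong \<alpha>(1)) simp
    then have "Y = pi1 G R C \<pi> (Der_rel G R B `` {(\<beta>, r)})"
      unfolding \<alpha>(2) pi1_eq[OF der] by (rule equiv_class_eq[OF equivs(3)])
    then show ?thesis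
      using der by (auto simp: H1_pair_def intro: quotientI)
  qed
  ultimately show ?thesis
    using pointed_map_pi1 pointed_map_delta1
    by (auto simp: pointed_exact_def pointed_map_def pH1_pair_def pH2_def)
qed

end

theorem theorem4p1:
  fixes G :: "'g topgroup" and R :: "('r, 'g) gmodule"
    and A :: "('a, 'g, 'r) bimodule" and B :: "('b, 'g, 'r) bimodule"
    and C :: "('c, 'g, 'r) bimodule"
    and \<iota> :: "'a \<Rightarrow> 'b" and \<pi> :: "'b \<Rightarrow> 'c"
  assumes "proper_extension G R A B C \<iota> \<pi>"
  shows "pointed_exact ({()}, ()) (\<lambda>_. \<one>\<^bsub>A\<^esub>) (pH0 G A) \<iota> (pH0 G B)
    \<and> pointed_exact (pH0 G A) \<iota> (pH0 G B) \<pi> (pH0 G C)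
    \<and> pointed_exact (pH0 G B) \<pi> (pH0 G C) (delta0 G A B \<iota> \<pi>) (pH1 G A)
    \<and> pointed_exact (pH0 G C) (delta0 G A B \<iota> \<pi>) (pH1 G A) (iota1 G R B \<iota>) (pH1_pair G R B)
    \<and> pointed_exact (pH1 G A) (iota1 G R B \<iota>) (pH1_pair G R B) (pi1 G R C \<pi>) (pH1_pair G R C)
    \<and> pointed_exact (pH1_pair G R B) (pi1 G R C \<pi>) (pH1_pair G R C)
        (delta1 G A B C \<iota> \<pi>) (pH2 G A)"
  using assms by (intro conjI proper_extension.exact_H0_A proper_extension.exact_H0_B
      proper_extension.exact_H0_C proper_extension.exact_H1_A proper_extension.exact_H1_B
      proper_extension.exact_H1_C)

end
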